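(* Consider the system $x(k+1)=A(k)x(k)+B(k)u(k)$, $x(0)=x_0\in\mathbb{R}^n$, composed of $N$ subsystems with the random matrices $A(k)$ satisfying the independence assumptions in the context. Suppose that for all $k$: $\mathbb{E}\{A(k)\}=\bar A\in\mathbb{R}^{n\times n}$, $\mathbb{E}\{A(k)\otimes A(k)\}=\Sigma\in\mathbb{R}^{n^2\times n^2}$, and $B(k)=B\in\mathbb{R}^{n\times m}$, with $\bar A,\Sigma,B$ independent of $k$. Suppose further that the system is mean square stabilizable (defined in the context). Let $Q\in\mathcal{S}_{++}^n$, $R=\mathrm{diag}(R_{11},\dots,R_{NN})\in\mathcal{S}_{++}^m$ with $R_{ii}\in\mathbb{R}^{m_i\times m_i}$, and $$J_\infty(x_0,\{u(k)\}_{k=0}^\infty)=\lim_{T\to\infty}\mathbb{E}\Big\{\sum_{k=0}^{T-1}\big(x(k)^\top Qx(k)+u(k)^\top Ru(k)\big)\Big\}.$$ Then the solution of the problem of minimizing $J_\infty$ over all control laws with limited model information (defined in the context) is given by $$u(k)=-(R+B^\top PB)^{-1}B^\top P\bar A x(k)-\begin{bmatrix}(R_{11}+B_1^\top PB_1)^{-1}B_1^\top P\tilde A_1(k)\\ \vdots\\ (R_{NN}+B_N^\top PB_N)^{-1}B_N^\top P\tilde A_N(k)\end{bmatrix}x(k),$$ where $P$ is the unique positive-definite solution of the modified discrete algebraic Riccati equation $$P=Q+\mathbf{R}(\bar A,P,B,R)+\sum_{i=1}^N\mathbb{E}\{\mathbf{R}(\tilde A_i(k),P,B_i,R_{ii})\}.$$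 Furthermore, the closed-loop system under this controller is mean square stable, and $\inf_{\{u(k)\}_{k=0}^\infty}J_\infty(x_0,\{u(k)\}_{k=0}^\infty)=x_0^\top Px_0$, the infimum being over control laws with limited model information.
   Context: Notation: $\mathcal{S}_{+}^n$ ($\mathcal{S}_{++}^n$) is the set of symmetric positive semidefinite (positive definite) matrices in $\mathbb{R}^{n\times n}$; $\otimes$ is the Kronecker product. The discrete Riccati operator is $\mathbf{R}(A,P,B,R)=A^\top(P-PB(R+B^\top PB)^{-1}B^\top P)A$ for $A\in\mathbb{R}^{n\times n}$, $P\in\mathcal{S}_+^n$, $B\in\mathbb{R}^{n\times m}$, $R\in\mathcal{S}_{++}^m$ (for any positive integers $n,m$). System: there are $N$ subsystems, subsystem $i$ having state $x_i(k)\in\mathbb{R}^{n_i}$, input $u_i(k)\in\mathbb{R}^{m_i}$ and dynamics $x_i(k+1)=\sum_{j=1}^N A_{ij}(k)x_j(k)+B_{ii}(k)u_i(k)$. Put $n=\sum_i n_i$, $m=\sum_i m_i$, $x(k)=[x_1(k)^\top\cdots x_N(k)^\top]^\top$, $u(k)=[u_1(k)^\top\cdots u_N(k)^\top]^\top$; then $x(k+1)=A(k)x(k)+B(k)u(k)$, with $A(k)=[A_{ij}(k)]_{i,j}$ and $B(k)=\mathrm{diag}(B_{11}(k),\dots,B_{NN}(k))$. The matrices $B_{ii}(k)$ and the initial state $x_0$ are deterministic; the $A_{ij}(k)\in\mathbb{R}^{n_i\times n_j}$ are random with finite first and second moments. Independence assumptions: the block rows $[A_{i1}(k)\;\cdots\;A_{iN}(k)]$,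 $1\le i\le N$, $k\ge0$, are mutually independent, both in time $k$ and across subsystems $i$ (blocks within the same block row at the same time may be dependent). Write $\tilde A_{ij}(k)=A_{ij}(k)-\mathbb{E}\{A_{ij}(k)\}$. When $B(k)=B$, $B_i\in\mathbb{R}^{n\times m_i}$ is the $i$-th block column of $B$ (its $i$-th block is $B_{ii}$, all other blocks are zero). $\tilde A_i(k)\in\mathbb{R}^{n\times n}$ has $i$-th block row $[\tilde A_{i1}(k)\;\cdots\;\tilde A_{iN}(k)]$ and all other block rows zero. Control laws with limited model information: the design of controller $i$ may use the exact local realizations $A_{i1}(k),\dots,A_{iN}(k)$ together with the first- and second-order moments of the $A(k)$, and the controller measures the full state. That is, at each time $k$, $u_i(k)=\psi_i(A_{i1}(k),\dots,A_{iN}(k);x(0),\dots,x(k))$ for $1\le i\le N$, where $\psi_i$ (possibly depending on $k$) is an arbitrary measurable mapping into $\mathbb{R}^{m_i}$, not necessarily linear. A closed-loop system is mean square stable if $\lim_{k\to+\infty}\mathbb{E}\{x(k)^\top x(k)\}=0$ for every initial state $x_0$. The system is mean square stabilizable if there exists a constant matrix $L\in\mathbb{R}^{m\times n}$ such that the closed-loop system with $u(k)=Lx(k)$ is mean square stable. *)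

theory Defs
  imports "HOL-Probability.Probability"
begin

section \<open>Matrices\<close>

definition sym_pos_def :: "real^'n^'n \<Rightarrow> bool" where
  "sym_pos_def M \<longleftrightarrow> transpose M = M \<and> (\<forall>x. x \<noteq> 0 \<longrightarrow> x \<bullet> (M *v x) > 0)"

definition kronecker :: "real^'b^'a \<Rightarrow> real^'d^'c \<Rightarrow> real^('b \<times> 'd)^('a \<times> 'c)" where
  "kronecker M N = (\<chi> p q. M $ fst p $ fst q * N $ snd p $ snd q)"

definition riccati ::
    "real^'n^'n \<Rightarrow> real^'n^'n \<Rightarrow> real^'m^'n \<Rightarrow> real^'m^'m \<Rightarrow> real^'n^'n" where
  "riccati A P B R =
     transpose A **
       (P - P ** B ** matrix_inv (R + transpose B ** P ** B) ** transpose B ** P) ** A"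


section \<open>Block structure\<close>

text \<open>
  The family of dimensions is encoded by a map from the coordinates to the subsystems that own
  them: coordinate \<open>p\<close> of the global state (input) belongs to subsystem \<open>\<sigma> p\<close>.
  So \<open>n\<^sub>i\<close> is the number of coordinates \<open>p\<close> with \<open>\<sigma> p = i\<close>, and a matrix
  with rows or columns of subsystem \<open>i\<close> only is padded with zeros to global size.
  In this encoding \<open>row_block \<sigma> i M\<close> is the block row \<open>[M\<^sub>i\<^sub>1 \<dots> M\<^sub>i\<^sub>N]\<close>,
  and equally the full-size matrix with that block row and zeros elsewhere;
  \<open>col_block \<tau> i M\<close> is the \<open>i\<close>-th block column, and \<open>diag_block \<tau> i M\<close>
  is the block \<open>M\<^sub>i\<^sub>i\<close>.
\<close>

definition row_block :: "('a \<Rightarrow> 's) \<Rightarrow> 's \<Rightarrow> real^'b^'a \<Rightarrow> real^'b^'a" where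
  "row_block \<sigma> i M = (\<chi> p q. if \<sigma> p = i then M $ p $ q else 0)"

definition col_block :: "('b \<Rightarrow> 's) \<Rightarrow> 's \<Rightarrow> real^'b^'a \<Rightarrow> real^'b^'a" where
  "col_block \<tau> i M = (\<chi> p q. if \<tau> q = i then M $ p $ q else 0)"

definition diag_block :: "('a \<Rightarrow> 's) \<Rightarrow> 's \<Rightarrow> real^'a^'a \<Rightarrow> real^'a^'a" where
  "diag_block \<tau> i M = (\<chi> p q. if \<tau> p = i \<and> \<tau> q = i then M $ p $ q else 0)"

definition block_diagonal :: "('a \<Rightarrow> 's) \<Rightarrow> ('b \<Rightarrow> 's) \<Rightarrow> real^'b^'a \<Rightarrow> bool" where
  "block_diagonal \<sigma> \<tau> M \<longleftrightarrow> (\<forall>p q. \<sigma> p \<noteq> \<tau> q \<longrightarrow> M $ p $ q = 0)"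

text \<open>Vertical stacking of the matrices \<open>G i\<close>: the rows of subsystem \<open>i\<close> come from \<open>G i\<close>.\<close>

definition stack_blocks :: "('a \<Rightarrow> 's) \<Rightarrow> ('s \<Rightarrow> real^'b^'a) \<Rightarrow> real^'b^'a" where
  "stack_blocks \<tau> G = (\<chi> p. G (\<tau> p) $ p)"

text \<open>
  Square matrices with rows and columns indexed by a set \<open>S\<close> of coordinates, padded with zeros:
  \<open>mat_on S\<close> is their identity, and \<open>inv_on S M\<close> is the (padded) inverse of
  the \<open>S \<times> S\<close> matrix \<open>M\<close>. As for \<open>matrix_inv\<close>, the value is arbitrary if no inverse exists.
\<close>

definition mat_on :: "'a set \<Rightarrow> real^'a^'a" where
  "mat_on S = (\<chi> p q. if p = q \<and> p \<in> S then 1 else 0)"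

definition inv_on :: "'a set \<Rightarrow> real^'a^'a \<Rightarrow> real^'a^'a" where
  "inv_on S M = (SOME X. (\<forall>p q. p \<notin> S \<or> q \<notin> S \<longrightarrow> X $ p $ q = 0)
                        \<and> M ** X = mat_on S \<and> X ** M = mat_on S)"

text \<open>
  The Riccati operator for inputs indexed by the set \<open>S\<close> of coordinates: the columns of \<open>B\<close>
  outside \<open>S\<close> and the entries of \<open>R\<close> outside \<open>S \<times> S\<close> are zero padding.
\<close>

definition riccati_on ::
    "'m set \<Rightarrow> real^'n^'n \<Rightarrow> real^'n^'n \<Rightarrow> real^'m^'n \<Rightarrow> real^'m^'m \<Rightarrow> real^'n^'n" where
  "riccati_on S A P B R =
     transpose A **
       (P - P ** B ** inv_on S (R + transpose B ** P ** B) ** transpose B ** P) ** A"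

lemma mat_on_mult_left:
  assumes "\<And>p q. p \<notin> S \<Longrightarrow> X $ p $ q = 0"
  shows "mat_on S ** X = (X :: real^'b^'a)"
proof -
  have "(\<Sum>k\<in>UNIV. (if p = k \<and> p \<in> S then 1 else 0) * X $ k $ q) = X $ p $ q" for p q
  proof -
    have "(\<Sum>k\<in>UNIV. (if p = k \<and> p \<in> S then 1 else 0) * X $ k $ q)
        = (\<Sum>k\<in>UNIV. if p = k then (if p \<in> S then X $ p $ q else 0) else 0)"
      by (intro sum.cong) auto
    then show ?thesis using assms by simp
  qed
  then show ?thesis
    by (simp add: vec_eq_iff matrix_matrix_mult_def mat_on_def)
qed

lemma mat_on_mult_right:
  assumes "\<And>p q. q \<notin> S \<Longrightarrow> X $ p $ q = 0"
  shows "X ** mat_on S = (X :: real^'a^'b)"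
proof -
  have "(\<Sum>k\<in>UNIV. X $ p $ k * (if k = q \<and> k \<in> S then 1 else 0)) = X $ p $ q" for p q
  proof -
    have "(\<Sum>k\<in>UNIV. X $ p $ k * (if k = q \<and> k \<in> S then 1 else 0))
        = (\<Sum>k\<in>UNIV. if k = q then (if q \<in> S then X $ p $ q else 0) else 0)"
      by (intro sum.cong) auto
    then show ?thesis using assms by simp
  qed
  then show ?thesis
    by (simp add: vec_eq_iff matrix_matrix_mult_def mat_on_def)
qed

lemma inv_on_eqI:
  assumes "\<And>p q. p \<notin> S \<or> q \<notin> S \<Longrightarrow> X $ p $ q = 0"
    and "M ** X = mat_on S" and "X ** M = mat_on S"
  shows "inv_on S M = X"
proof -
  define Y where "Y = inv_on S M"
  have "\<exists>X. (\<forall>p q. p \<notin> S \<or> q \<notin> S \<longrightarrow> X $ p $ q = 0) \<and> M ** X = mat_on S \<and> X ** M = mat_on S"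
    using assms by blast
  then have Y: "(\<forall>p q. p \<notin> S \<or> q \<notin> S \<longrightarrow> Y $ p $ q = 0) \<and> M ** Y = mat_on S \<and> Y ** M = mat_on S"
    unfolding Y_def inv_on_def by (rule someI_ex)
  have "Y = Y ** (M ** X)"
    using Y mat_on_mult_right[of S Y] assms(2) by simp
  also have "\<dots> = (Y ** M) ** X"
    by (simp add: matrix_mul_assoc)
  also have "\<dots> = X"
    using Y mat_on_mult_left[of S X] assms(1) by simp
  finally show ?thesis unfolding Y_def .
qed

lemma inv_on_UNIV: "inv_on UNIV M = matrix_inv M"
proof -
  have "mat_on UNIV = (mat 1 :: real^'a^'a)"
    by (simp add: mat_on_def mat_def vec_eq_iff)
  then show ?thesis
    by (simp add: inv_on_def matrix_inv_def)
qed

lemma riccati_on_UNIV: "riccati_on UNIV A P B R = riccati A P B R"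
  by (simp add: riccati_on_def riccati_def inv_on_UNIV)


section \<open>Systems and control\<close>

text \<open>
  \<open>A k \<omega>\<close> is the random matrix \<open>A(k)\<close>, an input sequence is a process \<open>u\<close>, and
  a feedback \<open>F\<close> chooses the input \<open>F k \<omega> (x(k))\<close>.
\<close>

primrec state ::
    "(nat \<Rightarrow> 'w \<Rightarrow> real^'n^'n) \<Rightarrow> real^'m^'n \<Rightarrow> real^'n \<Rightarrow> (nat \<Rightarrow> 'w \<Rightarrow> real^'m)
      \<Rightarrow> nat \<Rightarrow> 'w \<Rightarrow> real^'n" where
  "state A B x0 u 0 \<omega> = x0"
| "state A B x0 u (Suc k) \<omega> = A k \<omega> *v state A B x0 u k \<omega> + B *v u k \<omega>"

primrec closed_loop_state ::
    "(nat \<Rightarrow> 'w \<Rightarrow> real^'n^'n) \<Rightarrow> real^'m^'n \<Rightarrow> (nat \<Rightarrow> 'w \<Rightarrow> real^'n \<Rightarrow> real^'m) \<Rightarrow> real^'n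
      \<Rightarrow> nat \<Rightarrow> 'w \<Rightarrow> real^'n" where
  "closed_loop_state A B F x0 0 \<omega> = x0"
| "closed_loop_state A B F x0 (Suc k) \<omega> =
     A k \<omega> *v closed_loop_state A B F x0 k \<omega> + B *v F k \<omega> (closed_loop_state A B F x0 k \<omega>)"

definition closed_loop_input ::
    "(nat \<Rightarrow> 'w \<Rightarrow> real^'n^'n) \<Rightarrow> real^'m^'n \<Rightarrow> (nat \<Rightarrow> 'w \<Rightarrow> real^'n \<Rightarrow> real^'m) \<Rightarrow> real^'n
      \<Rightarrow> nat \<Rightarrow> 'w \<Rightarrow> real^'m" where
  "closed_loop_input A B F x0 k \<omega> = F k \<omega> (closed_loop_state A B F x0 k \<omega>)"

lemma state_closed_loop_input:
  "state A B x0 (closed_loop_input A B F x0) k \<omega> = closed_loop_state A B F x0 k \<omega>"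
  by (induction k) (simp_all add: closed_loop_input_def)

text \<open>
  Expectations of nonnegative variables are taken in \<open>[0, \<infinity>]\<close>, because the Bochner integral of
  a non-integrable function is 0.
\<close>

definition mean_square_stable ::
    "'w measure \<Rightarrow> (nat \<Rightarrow> 'w \<Rightarrow> real^'n^'n) \<Rightarrow> real^'m^'n
      \<Rightarrow> (nat \<Rightarrow> 'w \<Rightarrow> real^'n \<Rightarrow> real^'m) \<Rightarrow> bool" where
  "mean_square_stable M A B F \<longleftrightarrow>
     (\<forall>x0. (\<lambda>k. \<integral>\<^sup>+\<omega>. ennreal (closed_loop_state A B F x0 k \<omega> \<bullet> closed_loop_state A B F x0 k \<omega>) \<partial>M)
             \<longlonglongrightarrow> 0)"

definition mean_square_stabilizable ::
    "'w measure \<Rightarrow> (nat \<Rightarrow> 'w \<Rightarrow> real^'n^'n) \<Rightarrow> real^'m^'n \<Rightarrow> bool" where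
  "mean_square_stabilizable M A B \<longleftrightarrow>
     (\<exists>L :: real^'n^'m. mean_square_stable M A B (\<lambda>k \<omega> x. L *v x))"

text \<open>
  The input sequences that a control law with limited model information generates from \<open>x0\<close>:
  at time \<open>k\<close>, controller \<open>i\<close> applies a Borel map \<open>\<psi> k i\<close> to its own block row of \<open>A(k)\<close> and
  the states \<open>x(0), \<dots>, x(k)\<close>. Only the coordinates of \<open>\<psi> k i\<close> owned by subsystem \<open>i\<close> are used,
  which makes \<open>\<psi> k i\<close> a map into the input space of subsystem \<open>i\<close>.
\<close>

definition limited_info_inputs ::
    "'w measure \<Rightarrow> ('n \<Rightarrow> 's) \<Rightarrow> ('m \<Rightarrow> 's) \<Rightarrow> (nat \<Rightarrow> 'w \<Rightarrow> real^'n^'n) \<Rightarrow> real^'m^'n \<Rightarrow> real^'n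
      \<Rightarrow> (nat \<Rightarrow> 'w \<Rightarrow> real^'m) set" where
  "limited_info_inputs M \<sigma> \<tau> A B x0 =
     {u. \<exists>\<psi> :: nat \<Rightarrow> 's \<Rightarrow> (real^'n^'n) \<times> (nat \<Rightarrow> real^'n) \<Rightarrow> real^'m.
           (\<forall>k i. \<psi> k i \<in> borel_measurable (borel \<Otimes>\<^sub>M (\<Pi>\<^sub>M j\<in>{..k}. borel))) \<and>
           (\<forall>k. \<forall>\<omega>\<in>space M. \<forall>q.
              u k \<omega> $ q =
                \<psi> k (\<tau> q) (row_block \<sigma> (\<tau> q) (A k \<omega>), \<lambda>j\<in>{..k}. state A B x0 u j \<omega>) $ q)}"

text \<open>
  The cost functional. For the positive definite weights of interest the stage costs are
  nonnegative, so \<open>ennreal\<close> truncates nothing and the limit exists in \<open>[0, \<infinity>]\<close>.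
\<close>

definition cost ::
    "'w measure \<Rightarrow> (nat \<Rightarrow> 'w \<Rightarrow> real^'n^'n) \<Rightarrow> real^'m^'n \<Rightarrow> real^'n^'n \<Rightarrow> real^'m^'m
      \<Rightarrow> real^'n \<Rightarrow> (nat \<Rightarrow> 'w \<Rightarrow> real^'m) \<Rightarrow> ennreal" where
  "cost M A B Q R x0 u =
     lim (\<lambda>T. \<integral>\<^sup>+\<omega>. ennreal (\<Sum>k<T. state A B x0 u k \<omega> \<bullet> (Q *v state A B x0 u k \<omega>)
                                    + u k \<omega> \<bullet> (R *v u k \<omega>)) \<partial>M)"

definition centered :: "'w measure \<Rightarrow> ('w \<Rightarrow> real^'b^'a) \<Rightarrow> 'w \<Rightarrow> real^'b^'a" where
  "centered M X \<omega> = X \<omega> - (\<integral>\<omega>'. X \<omega>' \<partial>M)"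

definition modified_dare ::
    "'w measure \<Rightarrow> ('n \<Rightarrow> 's) \<Rightarrow> ('m \<Rightarrow> 's) \<Rightarrow> (nat \<Rightarrow> 'w \<Rightarrow> real^'n^'n) \<Rightarrow> real^'n^'n \<Rightarrow> real^'m^'n
      \<Rightarrow> real^'n^'n \<Rightarrow> real^'m^'m \<Rightarrow> nat \<Rightarrow> real^'n^'n \<Rightarrow> bool" where
  "modified_dare M \<sigma> \<tau> A Abar B Q R k P \<longleftrightarrow>
     P = Q + riccati Abar P B R
       + (\<Sum>i\<in>UNIV. \<integral>\<omega>. riccati_on {q. \<tau> q = i} (row_block \<sigma> i (centered M (A k) \<omega>)) P
                              (col_block \<tau> i B) (diag_block \<tau> i R) \<partial>M)"

definition optimal_feedback ::
    "'w measure \<Rightarrow> ('n \<Rightarrow> 's) \<Rightarrow> ('m \<Rightarrow> 's) \<Rightarrow> (nat \<Rightarrow> 'w \<Rightarrow> real^'n^'n) \<Rightarrow> real^'n^'n \<Rightarrow> real^'m^'n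
      \<Rightarrow> real^'m^'m \<Rightarrow> real^'n^'n \<Rightarrow> nat \<Rightarrow> 'w \<Rightarrow> real^'n \<Rightarrow> real^'m" where
  "optimal_feedback M \<sigma> \<tau> A Abar B R P k \<omega> x =
     - ((matrix_inv (R + transpose B ** P ** B) ** transpose B ** P ** Abar) *v x)
     - stack_blocks \<tau> (\<lambda>i.
         inv_on {q. \<tau> q = i}
           (diag_block \<tau> i R + transpose (col_block \<tau> i B) ** P ** col_block \<tau> i B)
         ** transpose (col_block \<tau> i B) ** P ** row_block \<sigma> i (centered M (A k) \<omega>)) *v x"

end

theory Submission
  imports Defs
begin

text \<open>
  The proof is dynamic programming. For a fixed state \<open>x\<close> and a positive semidefinite \<open>P\<close>,
  split the input at one time into its mean and the fluctuations of the subsystems. The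
  fluctuation of subsystem \<open>i\<close>, together with the fluctuation of the \<open>i\<close>-th block row of \<open>A(k)\<close>,
  is a centered random vector, and for distinct subsystems these vectors are independent.
  So the expected one-step cost \<open>u \<bullet> R u + (A x + B u) \<bullet> P (A x + B u)\<close> has no cross terms, and
  completing the square in the mean and in each fluctuation separately shows that its minimum over
  inputs with limited model information is \<open>x \<bullet> T(P) x\<close>, where \<open>Q + T(P)\<close> is the right-hand side
  of the modified Riccati equation, and that the stated controller attains it
  (\<open>one_step_identity\<close>, \<open>one_step_ge\<close>, \<open>integral_step_cost_optimal\<close>).
  The matrix at time \<open>k\<close> is independent of the states up to time \<open>k\<close>, so this carries over to the
  controlled process by Fubini (\<open>nn_integral_past_present\<close>).

  Existence of a fixed point comes from the value iteration \<open>P \<mapsto> Q + T(P)\<close> started at 0. The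
  iterates increase, and they are bounded because a mean square stabilizing gain has finite
  cost (\<open>stabilizing_feedback_bound\<close>). That the limit is a fixed point uses, in place of
  continuity, the comparison \<open>T(X) \<le> c T(Y)\<close> for \<open>X \<le> c Y\<close> and \<open>c \<ge> 1\<close>
  (\<open>riccati_map_compare\<close>), which follows from the minimum property.

  For verification, let \<open>P\<close> be a fixed point. Along every law, \<open>x0 \<bullet> P x0\<close> is at most the cost
  up to time \<open>T\<close> plus \<open>E[x(T) \<bullet> P x(T)]\<close>, with equality for the controller of \<open>P\<close>. If the
  total cost is finite, the last term tends to 0 because \<open>Q\<close> is positive definite. Hence
  \<open>x0 \<bullet> P x0\<close> is the optimal cost, the optimal loop is mean square stable, and, since the
  optimal cost does not depend on the choice of the fixed point, the fixed point is unique.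
\<close>

section \<open>Quadratic forms\<close>

text \<open>Symmetric positive semidefinite matrices.\<close>

definition sym_pos_semidef :: "real^'n^'n \<Rightarrow> bool" where
  "sym_pos_semidef X \<longleftrightarrow> transpose X = X \<and> (\<forall>x. 0 \<le> x \<bullet> (X *v x))"

lemma sym_pos_semidefD:
  assumes "sym_pos_semidef X"
  shows "transpose X = X" "0 \<le> x \<bullet> (X *v x)"
  using assms by (auto simp: sym_pos_semidef_def)

lemma sym_pos_def_imp_semidef: "sym_pos_def X \<Longrightarrow> sym_pos_semidef X"
  unfolding sym_pos_def_def sym_pos_semidef_def
  by (metis inner_zero_left less_eq_real_def)

lemma matrix_vector_minus: "D *v (- x) = - (D *v x :: real^'m)"
  using matrix_vector_mult_diff_distrib[of D 0 x] by simp

lemma norm_matrix_vector_le: "norm (D *v x) \<le> norm D * norm (x :: real^'n)"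
  for D :: "real^'n^'m"
proof -
  have "norm (D *v x) = L2_set (\<lambda>i. norm (D $ i \<bullet> x)) UNIV"
    by (simp add: norm_vec_def matrix_mult_dot)
  also have "\<dots> \<le> L2_set (\<lambda>i. norm (D $ i) * norm x) UNIV"
    by (intro L2_set_mono) (auto simp: Cauchy_Schwarz_ineq2)
  also have "\<dots> = norm D * norm x"
    by (simp add: norm_vec_def L2_set_left_distrib)
  finally show ?thesis .
qed

lemma bounded_bilinear_matrix_vector:
  "bounded_bilinear ((*v) :: real^'n^'m \<Rightarrow> real^'n \<Rightarrow> real^'m)"
proof
  fix D D' :: "real^'n^'m" and x y :: "real^'n" and r :: real
  show "(D + D') *v x = D *v x + D' *v x" by (simp add: algebra_simps)
  show "D *v (x + y) = D *v x + D *v y" by (simp add: algebra_simps)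
  show "(r *\<^sub>R D) *v x = r *\<^sub>R (D *v x)" by (simp add: scaleR_matrix_vector_assoc)
  show "D *v (r *\<^sub>R x) = r *\<^sub>R (D *v x)" by (simp add: matrix_vector_mult_scaleR)
  show "\<exists>K. \<forall>a b. norm ((a :: real^'n^'m) *v b) \<le> norm a * norm b * K"
    by (rule exI[of _ 1]) (simp add: norm_matrix_vector_le)
qed

lemma borel_measurable_matrix_vector [measurable]:
  assumes "f \<in> borel_measurable N" and "g \<in> borel_measurable N"
  shows "(\<lambda>\<omega>. (f \<omega> :: real^'n^'m) *v g \<omega>) \<in> borel_measurable N"
  using assms
  by (rule borel_measurable_continuous_Pair)
    (intro bounded_bilinear.continuous_on[OF bounded_bilinear_matrix_vector] continuous_intros)

lemma inner_transpose: "x \<bullet> (transpose D *v y) = (D *v x) \<bullet> (y :: real^'m)"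
  for D :: "real^'n^'m"
  by (metis dot_lmul_matrix inner_commute transpose_matrix_vector)

lemma inner_symmetric:
  assumes "transpose X = X"
  shows "x \<bullet> (X *v y) = y \<bullet> (X *v (x :: real^'n))"
  by (metis assms inner_commute inner_transpose)

lemma quadratic_form_le_norm: "\<bar>x \<bullet> (D *v x)\<bar> \<le> norm D * (x \<bullet> (x :: real^'n))"
proof -
  have "\<bar>x \<bullet> (D *v x)\<bar> \<le> norm x * norm (D *v x)" by (rule Cauchy_Schwarz_ineq2)
  also have "\<dots> \<le> norm x * (norm D * norm x)"
    by (intro mult_left_mono norm_matrix_vector_le) auto
  finally show ?thesis by (simp add: dot_square_norm power2_eq_square mult_ac)
qed

lemma quadratic_form_add:
  assumes "transpose X = X"
  shows "(x + y) \<bullet> (X *v (x + y)) = x \<bullet> (X *v x) + 2 * (x \<bullet> (X *v y)) + y \<bullet> (X *v (y :: real^'n))"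
  using inner_symmetric[OF assms, of x y]
  by (simp add: algebra_simps inner_add_left inner_add_right matrix_vector_right_distrib)

lemma matrix_entry_polarization:
  assumes "transpose X = X"
  shows "X $ i $ j = ((axis i 1 + axis j 1) \<bullet> (X *v (axis i 1 + axis j 1))
      - axis i 1 \<bullet> (X *v axis i 1) - axis j 1 \<bullet> (X *v axis j (1::real))) / 2"
proof -
  have "axis i 1 \<bullet> (X *v axis j 1) = X $ i $ j"
    by (simp add: inner_axis' matrix_vector_mul_component inner_axis)
  then show ?thesis
    unfolding quadratic_form_add[OF assms] by simp
qed

lemma symmetric_matrix_eqI:
  assumes "transpose X = X" "transpose Y = Y"
    and "\<And>x. x \<bullet> (X *v x) = x \<bullet> (Y *v (x :: real^'n))"
  shows "X = Y"
  unfolding vec_eq_iff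
  by (simp add: matrix_entry_polarization[OF assms(1)] matrix_entry_polarization[OF assms(2)] assms(3))

lemma sym_pos_def_lower_bound:
  assumes "sym_pos_def (X :: real^'n^'n)"
  obtains c where "0 < c" and "\<And>x. c * (x \<bullet> x) \<le> x \<bullet> (X *v x)"
proof -
  have cont: "continuous_on (sphere 0 1) (\<lambda>x. x \<bullet> (X *v x))"
    by (intro continuous_intros bounded_bilinear.continuous_on[OF bounded_bilinear_matrix_vector])
  have "axis undefined 1 \<in> sphere (0 :: real^'n) 1" by (simp add: norm_axis_1)
  then have "sphere (0 :: real^'n) 1 \<noteq> {}" by blast
  with cont obtain z where z: "z \<in> sphere 0 1"
    and le: "\<And>x. x \<in> sphere 0 1 \<Longrightarrow> z \<bullet> (X *v z) \<le> x \<bullet> (X *v x)"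
    using continuous_attains_inf[of "sphere (0 :: real^'n) 1" "\<lambda>x. x \<bullet> (X *v x)"] by auto
  show thesis
  proof (rule that)
    show "0 < z \<bullet> (X *v z)" using assms z unfolding sym_pos_def_def
      by (metis mem_sphere_0 norm_zero zero_neq_one)
    fix x :: "real^'n"
    show "(z \<bullet> (X *v z)) * (x \<bullet> x) \<le> x \<bullet> (X *v x)"
    proof (cases "x = 0")
      case False
      have "z \<bullet> (X *v z) \<le> (x /\<^sub>R norm x) \<bullet> (X *v (x /\<^sub>R norm x))"
        using False by (intro le) simp
      also have "\<dots> = (x \<bullet> (X *v x)) / (norm x)\<^sup>2"
        by (simp add: matrix_vector_mult_scaleR power2_eq_square field_simps)
      finally show ?thesis using False by (simp add: field_simps dot_square_norm)
    qed simp
  qed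
qed


section \<open>Completing the square on a block of inputs\<close>

lemma transpose_add: "transpose (X + Y) = transpose X + transpose (Y :: real^'n^'m)"
  by (simp add: transpose_def vec_eq_iff)

lemma transpose_congruence:
  assumes "transpose P = P"
  shows "transpose (transpose D ** P ** D) = transpose D ** P ** (D :: real^'m^'n)"
  by (simp add: matrix_transpose_mul matrix_mul_assoc assms)

text \<open>
  The vector \<open>w\<close> is a stationary point of the cost in \<open>v\<close>; no invertibility of \<open>H\<close> is needed.
\<close>

lemma completion_of_squares:
  fixes Bs :: "real^'m^'n"
  assumes R: "transpose Rs = Rs" and P: "transpose P = P"
    and H: "H = Rs + transpose Bs ** P ** Bs"
    and w: "H *v w = - (transpose Bs *v (P *v a))"
  shows "v \<bullet> (Rs *v v) + (a + Bs *v v) \<bullet> (P *v (a + Bs *v v))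
    = a \<bullet> (P *v a) + (Bs *v w) \<bullet> (P *v a) + (v - w) \<bullet> (H *v (v - w))"
proof -
  have tH: "transpose H = H"
    unfolding H by (simp add: transpose_add transpose_congruence[OF P] R)
  have qH: "v \<bullet> (H *v v) = v \<bullet> (Rs *v v) + (Bs *v v) \<bullet> (P *v (Bs *v v))" for v
    unfolding H
    by (simp add: matrix_vector_mult_add_rdistrib inner_add_right inner_transpose
        flip: matrix_vector_mul_assoc del: transpose_matrix_vector)
  have Hw: "v \<bullet> (H *v w) = - ((Bs *v v) \<bullet> (P *v a))" for v
    unfolding w by (simp add: inner_transpose del: transpose_matrix_vector)
  have "(v - w) \<bullet> (H *v (v - w)) = v \<bullet> (H *v v) - 2 * (v \<bullet> (H *v w)) + w \<bullet> (H *v w)"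
    using inner_symmetric[OF tH, of v w]
    by (simp add: inner_diff_left inner_diff_right matrix_vector_mult_diff_distrib)
  then show ?thesis
    using inner_symmetric[OF P, of a "Bs *v v"] Hw[of v] Hw[of w] qH[of v]
    by (simp add: quadratic_form_add[OF P])
qed

lemma quadratic_form_congruence:
  "v \<bullet> ((transpose D ** P ** D) *v v) = (D *v v) \<bullet> (P *v (D *v (v :: real^'m)))"
  by (simp add: inner_transpose flip: matrix_vector_mul_assoc del: transpose_matrix_vector)

lemma sym_pos_semidef_add:
  "sym_pos_semidef X \<Longrightarrow> sym_pos_semidef Y \<Longrightarrow> sym_pos_semidef (X + Y)"
  by (simp add: sym_pos_semidef_def transpose_add matrix_vector_mult_add_rdistrib inner_add_right)

lemma sym_pos_semidef_congruence:
  "sym_pos_semidef P \<Longrightarrow> sym_pos_semidef (transpose D ** P ** D)"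
  by (simp add: sym_pos_semidef_def transpose_congruence quadratic_form_congruence)

lemma matrix_add_rdistrib: "(X + Y) ** Z = X ** Z + Y ** (Z :: real^'k^'m)"
  for X Y :: "real^'m^'n"
  by (simp add: matrix_matrix_mult_def vec_eq_iff sum.distrib distrib_right)

lemma mat_on_mult_mat_on: "mat_on S ** mat_on S = (mat_on S :: real^'a^'a)"
  by (rule mat_on_mult_left) (simp add: mat_on_def)

lemma mat_on_vector: "mat_on S *v v = (\<chi> q. if q \<in> S then v $ q else 0)"
  by (simp add: mat_on_def matrix_vector_mult_def vec_eq_iff if_distrib[of "\<lambda>x. x * _"] cong: if_cong)

text \<open>
  A zero-padded matrix that is positive definite on the block \<open>S \<times> S\<close> has a padded inverse:
  it is the \<open>S \<times> S\<close> block of the inverse of the matrix completed by an identity block.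
\<close>

lemma inv_on_positive:
  fixes H :: "real^'m^'m"
  assumes pad: "\<And>p q. p \<notin> S \<or> q \<notin> S \<Longrightarrow> H $ p $ q = 0"
    and pos: "\<And>v. v \<noteq> 0 \<Longrightarrow> (\<And>q. q \<notin> S \<Longrightarrow> v $ q = 0) \<Longrightarrow> 0 < v \<bullet> (H *v v)"
  shows "p \<notin> S \<or> q \<notin> S \<Longrightarrow> inv_on S H $ p $ q = 0"
    and "H ** inv_on S H = mat_on S" and "inv_on S H ** H = mat_on S"
proof -
  \<comment> \<open>identity on the complement of the block makes the matrix invertible\<close>
  define G where "G = H + mat_on (- S)"
  have HE: "H ** mat_on S = H" and EH: "mat_on S ** H = H"
    using pad by (auto intro: mat_on_mult_right mat_on_mult_left)
  have EE': "mat_on (- S) ** mat_on S = (0 :: real^'m^'m)" "mat_on S ** mat_on (- S) = (0 :: real^'m^'m)"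
    by (auto simp: mat_on_def matrix_matrix_mult_def vec_eq_iff intro!: sum.neutral)
  have GE: "G ** mat_on S = H" and EG: "mat_on S ** G = H"
    by (simp_all add: G_def matrix_add_ldistrib matrix_add_rdistrib HE EH EE')
  have "v = 0" if "G *v v = 0" for v
  proof -
    have *: "(H *v v) $ q + (if q \<notin> S then v $ q else 0) = 0" for q
      using that by (simp add: G_def matrix_vector_mult_add_rdistrib mat_on_vector vec_eq_iff)
    have supp: "v $ q = 0" if "q \<notin> S" for q
      using *[of q] that pad by (simp add: matrix_vector_mult_def)
    have "(H *v v) $ q = 0" for q using *[of q] supp[of q] by (simp split: if_splits)
    then have "H *v v = 0" by (simp add: vec_eq_iff)
    then show "v = 0" using pos[of v] supp by auto
  qed
  then obtain N where NG: "N ** G = mat 1" using matrix_left_invertible_ker by blast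
  then have GN: "G ** N = mat 1" using matrix_left_right_inverse by blast
  have NH: "N ** H = mat_on S" and HN: "H ** N = mat_on S"
    unfolding GE[symmetric] by (simp add: matrix_mul_assoc NG)
      (simp add: GE EG[symmetric] matrix_mul_assoc[symmetric] GN)
  have comm: "mat_on S ** N = N ** mat_on S"
    by (metis NH HN matrix_mul_assoc)
  define X where "X = mat_on S ** N"
  have padX: "X $ p $ q = 0" if "p \<notin> S \<or> q \<notin> S" for p q
  proof (cases "p \<in> S")
    case False
    then show ?thesis
      by (auto simp: X_def mat_on_def matrix_matrix_mult_def intro!: sum.neutral)
  next
    case True
    then have "(N ** mat_on S) $ p $ q = 0" using that
      by (auto simp: mat_on_def matrix_matrix_mult_def intro!: sum.neutral)
    then show ?thesis unfolding X_def comm .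
  qed
  have HX: "H ** X = mat_on S" and XH: "X ** H = mat_on S"
    unfolding X_def
    by (simp add: comm matrix_mul_assoc HN mat_on_mult_mat_on)
      (simp add: matrix_mul_assoc[symmetric] NH mat_on_mult_mat_on)
  have X: "inv_on S H = X"
    using padX HX XH by (rule inv_on_eqI)
  show "p \<notin> S \<or> q \<notin> S \<Longrightarrow> inv_on S H $ p $ q = 0" "H ** inv_on S H = mat_on S"
    "inv_on S H ** H = mat_on S"
    unfolding X using padX HX XH by auto
qed

lemma inv_on_symmetric:
  fixes H :: "real^'m^'m"
  assumes tH: "transpose H = H"
    and pad: "\<And>p q. p \<notin> S \<or> q \<notin> S \<Longrightarrow> H $ p $ q = 0"
    and pos: "\<And>v. v \<noteq> 0 \<Longrightarrow> (\<And>q. q \<notin> S \<Longrightarrow> v $ q = 0) \<Longrightarrow> 0 < v \<bullet> (H *v v)"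
  shows "transpose (inv_on S H) = inv_on S H"
proof (rule inv_on_eqI[symmetric])
  have inv: "H ** inv_on S H = mat_on S" "inv_on S H ** H = mat_on S"
    "\<And>p q. p \<notin> S \<or> q \<notin> S \<Longrightarrow> inv_on S H $ p $ q = 0"
    by (rule inv_on_positive(2)[OF pad pos], assumption+, rule inv_on_positive(3)[OF pad pos],
        assumption+, rule inv_on_positive(1)[OF pad pos], assumption+)
  have tE: "transpose (mat_on S) = (mat_on S :: real^'m^'m)"
    by (auto simp: mat_on_def transpose_def vec_eq_iff)
  show "transpose (inv_on S H) $ p $ q = 0" if "p \<notin> S \<or> q \<notin> S" for p q
    using that by (auto simp: transpose_def intro!: inv(3))
  show "H ** transpose (inv_on S H) = mat_on S"
    using arg_cong[OF inv(2), of transpose] by (simp add: matrix_transpose_mul tH tE)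
  show "transpose (inv_on S H) ** H = mat_on S"
    using arg_cong[OF inv(1), of transpose] by (simp add: matrix_transpose_mul tH tE)
qed

text \<open>Zero-padded weights of an input block \<open>S\<close>, positive definite on the block.\<close>

locale input_block =
  fixes S :: "'m::finite set" and Bs :: "real^'m^'n::finite" and Rs :: "real^'m^'m" and P :: "real^'n^'n"
  assumes R_symmetric: "transpose Rs = Rs" and P_semidef: "sym_pos_semidef P"
    and R_pad: "\<And>p q. p \<notin> S \<or> q \<notin> S \<Longrightarrow> Rs $ p $ q = 0"
    and R_positive: "\<And>v. v \<noteq> 0 \<Longrightarrow> (\<And>q. q \<notin> S \<Longrightarrow> v $ q = 0) \<Longrightarrow> 0 < v \<bullet> (Rs *v v)"
    and B_pad: "\<And>p q. q \<notin> S \<Longrightarrow> Bs $ p $ q = 0"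
begin

text \<open>
  Half the second derivative of the stage cost in the input.
\<close>

definition hessian :: "real^'m^'m" where
  "hessian = Rs + transpose Bs ** P ** Bs"

lemma P_symmetric: "transpose P = P"
  using P_semidef by (rule sym_pos_semidefD)

lemma hessian_symmetric: "transpose hessian = hessian"
  by (simp add: hessian_def transpose_add transpose_congruence P_symmetric R_symmetric)

lemma hessian_pad: "p \<notin> S \<or> q \<notin> S \<Longrightarrow> hessian $ p $ q = 0"
proof -
  assume *: "p \<notin> S \<or> q \<notin> S"
  have "(transpose Bs ** P ** Bs) $ p $ q = 0"
  proof (cases "q \<in> S")
    case False
    then show ?thesis using B_pad by (simp add: matrix_matrix_mult_def)
  next
    case True
    then have "p \<notin> S" using * by simp
    then show ?thesis using B_pad
      by (simp add: matrix_matrix_mult_def transpose_def flip: matrix_mul_assoc)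
  qed
  then show ?thesis using * R_pad unfolding hessian_def by simp
qed

lemma hessian_positive:
  assumes "v \<noteq> 0" "\<And>q. q \<notin> S \<Longrightarrow> v $ q = 0"
  shows "0 < v \<bullet> (hessian *v v)"
proof -
  have "v \<bullet> (hessian *v v) = v \<bullet> (Rs *v v) + (Bs *v v) \<bullet> (P *v (Bs *v v))"
    unfolding hessian_def
    by (simp add: matrix_vector_mult_add_rdistrib inner_add_right quadratic_form_congruence)
  then show ?thesis
    using R_positive[OF assms] sym_pos_semidefD(2)[OF P_semidef, of "Bs *v v"] by simp
qed

lemma hessian_inv: "hessian ** inv_on S hessian = mat_on S"
  by (rule inv_on_positive(2)[OF hessian_pad hessian_positive])

lemma riccati_on_symmetric: "transpose (riccati_on S D P Bs Rs) = riccati_on S D P Bs Rs"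
proof -
  have tX: "transpose (inv_on S hessian) = inv_on S hessian"
    by (rule inv_on_symmetric[OF hessian_symmetric hessian_pad hessian_positive])
  have tdiff: "transpose (X - Y) = transpose X - transpose Y" for X Y :: "real^'n^'n"
    by (simp add: transpose_def vec_eq_iff)
  show ?thesis
    unfolding riccati_on_def hessian_def[symmetric]
    by (intro transpose_congruence)
      (simp add: tdiff matrix_transpose_mul P_symmetric tX matrix_mul_assoc)
qed

text \<open>
  The Riccati operator is the minimum over the inputs \<open>v\<close> of a quadratic stage cost, and the
  excess over the minimum is the quadratic form of the Hessian at the distance from the minimizer.
\<close>

lemma riccati_on_completion:
  defines "G \<equiv> inv_on S hessian ** transpose Bs ** P"
  shows "v \<bullet> (Rs *v v) + (D *v x + Bs *v v) \<bullet> (P *v (D *v x + Bs *v v))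
    = x \<bullet> (riccati_on S D P Bs Rs *v x)
      + (v + G ** D *v x) \<bullet> (hessian *v (v + G ** D *v x))"
proof -
  define w where "w = - (G ** D *v x)"
  have BE: "mat_on S ** transpose Bs = transpose Bs"
    using B_pad by (intro mat_on_mult_left) (simp add: transpose_def)
  have "hessian *v w = - ((hessian ** inv_on S hessian) *v (transpose Bs *v (P *v (D *v x))))"
    unfolding w_def G_def
    by (simp add: matrix_vector_minus matrix_vector_mul_assoc matrix_mul_assoc del: transpose_matrix_vector)
  also have "\<dots> = - (transpose Bs *v (P *v (D *v x)))"
    by (simp add: hessian_inv BE matrix_vector_mul_assoc matrix_mul_assoc
        del: transpose_matrix_vector)
  finally have Hw: "hessian *v w = - (transpose Bs *v (P *v (D *v x)))" .
  have "x \<bullet> (riccati_on S D P Bs Rs *v x)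
      = (D *v x) \<bullet> (P *v (D *v x)) + (D *v x) \<bullet> (P *v (Bs *v w))"
    unfolding riccati_on_def w_def G_def hessian_def[symmetric]
    by (simp add: inner_transpose matrix_vector_mult_diff_rdistrib inner_diff_right matrix_vector_minus
        flip: matrix_vector_mul_assoc del: transpose_matrix_vector)
  then show ?thesis
    using completion_of_squares[OF R_symmetric P_symmetric hessian_def Hw, of v]
      inner_symmetric[OF P_symmetric, of "D *v x" "Bs *v w"]
    by (simp add: w_def)
qed

end

section \<open>Square integrable random vectors\<close>

text \<open>
  A measurable map into a Euclidean space with finite second moment.
\<close>

definition sq_integrable :: "'w measure \<Rightarrow> ('w \<Rightarrow> 'a::euclidean_space) \<Rightarrow> bool" where
  "sq_integrable M f \<longleftrightarrow> f \<in> borel_measurable M \<and> integrable M (\<lambda>\<omega>. (norm (f \<omega>))\<^sup>2)"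

lemma sq_integrable_measurable: "sq_integrable M f \<Longrightarrow> f \<in> borel_measurable M"
  by (simp add: sq_integrable_def)

lemma sq_integrable_dominated:
  assumes "sq_integrable M f" "g \<in> borel_measurable M" "\<And>\<omega>. norm (g \<omega>) \<le> c * norm (f \<omega>)"
  shows "sq_integrable M g"
proof -
  have "integrable M (\<lambda>\<omega>. c\<^sup>2 * (norm (f \<omega>))\<^sup>2)"
    using assms(1) by (simp add: sq_integrable_def)
  then have "integrable M (\<lambda>\<omega>. (norm (g \<omega>))\<^sup>2)"
    by (rule Bochner_Integration.integrable_bound)
      (use assms(2) power_mono[OF assms(3), where n = 2] in \<open>auto simp: power_mult_distrib\<close>)
  with assms(2) show ?thesis by (simp add: sq_integrable_def)
qed

lemma sq_integrable_add:
  assumes f: "sq_integrable M f" and g: "sq_integrable M g"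
  shows "sq_integrable M (\<lambda>\<omega>. f \<omega> + g \<omega>)"
proof -
  have [measurable]: "f \<in> borel_measurable M" "g \<in> borel_measurable M"
    using f g by (auto simp: sq_integrable_def)
  have "integrable M (\<lambda>\<omega>. 2 * (norm (f \<omega>))\<^sup>2 + 2 * (norm (g \<omega>))\<^sup>2)"
    using f g by (simp add: sq_integrable_def)
  then have "integrable M (\<lambda>\<omega>. (norm (f \<omega> + g \<omega>))\<^sup>2)"
  proof (rule Bochner_Integration.integrable_bound, goal_cases)
    case 2
    have "(norm (f \<omega> + g \<omega>))\<^sup>2 \<le> 2 * (norm (f \<omega>))\<^sup>2 + 2 * (norm (g \<omega>))\<^sup>2" for \<omega>
      using power_mono[OF norm_triangle_ineq[of "f \<omega>" "g \<omega>"], where n = 2]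
        sum_squares_bound[of "norm (f \<omega>)" "norm (g \<omega>)"]
      by (simp add: power2_sum)
    then show ?case by simp
  qed simp
  then show ?thesis by (simp add: sq_integrable_def)
qed

lemma sq_integrable_minus: "sq_integrable M f \<Longrightarrow> sq_integrable M (\<lambda>\<omega>. - f \<omega>)"
  by (rule sq_integrable_dominated[where c = 1]) (auto simp: sq_integrable_def)

lemma sq_integrable_diff:
  "sq_integrable M f \<Longrightarrow> sq_integrable M g \<Longrightarrow> sq_integrable M (\<lambda>\<omega>. f \<omega> - g \<omega>)"
  using sq_integrable_add[OF _ sq_integrable_minus, of M f g] by simp

lemma sq_integrable_matrix_vector:
  fixes D :: "real^'n^'m"
  assumes "sq_integrable M f"
  shows "sq_integrable M (\<lambda>\<omega>. D *v f \<omega>)"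
  using assms borel_measurable_matrix_vector[OF borel_measurable_const sq_integrable_measurable[OF assms]]
  by (rule sq_integrable_dominated[where c = "norm D"]) (rule norm_matrix_vector_le)

lemma sq_integrable_matrix_vector_const:
  fixes D :: "'w \<Rightarrow> real^'n^'m"
  assumes "sq_integrable M D"
  shows "sq_integrable M (\<lambda>\<omega>. D \<omega> *v x)"
  using assms borel_measurable_matrix_vector[OF sq_integrable_measurable[OF assms] borel_measurable_const]
  by (rule sq_integrable_dominated[where c = "norm x"]) (metis mult.commute norm_matrix_vector_le)

lemma sq_integrable_inner:
  assumes f: "sq_integrable M f" and g: "sq_integrable M g"
  shows "integrable M (\<lambda>\<omega>. f \<omega> \<bullet> g \<omega>)"
proof -
  have [measurable]: "f \<in> borel_measurable M" "g \<in> borel_measurable M"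
    using f g by (auto simp: sq_integrable_def)
  have "integrable M (\<lambda>\<omega>. (norm (f \<omega>))\<^sup>2 + (norm (g \<omega>))\<^sup>2)"
    using f g by (simp add: sq_integrable_def)
  then show ?thesis
  proof (rule Bochner_Integration.integrable_bound, goal_cases)
    case 2
    have "\<bar>f \<omega> \<bullet> g \<omega>\<bar> \<le> (norm (f \<omega>))\<^sup>2 + (norm (g \<omega>))\<^sup>2" for \<omega>
    proof -
      have "\<bar>f \<omega> \<bullet> g \<omega>\<bar> \<le> norm (f \<omega>) * norm (g \<omega>)" by (rule Cauchy_Schwarz_ineq2)
      also have "\<dots> \<le> 2 * norm (f \<omega>) * norm (g \<omega>)" by simp
      also have "\<dots> \<le> (norm (f \<omega>))\<^sup>2 + (norm (g \<omega>))\<^sup>2" by (rule sum_squares_bound)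
      finally show ?thesis .
    qed
    then show ?case by simp
  qed simp
qed

lemma sq_integrable_quadratic:
  "sq_integrable M f \<Longrightarrow> integrable M (\<lambda>\<omega>. f \<omega> \<bullet> (W *v f \<omega>))" for W :: "real^'n^'n"
  by (intro sq_integrable_inner sq_integrable_matrix_vector)

lemma integrable_vec:
  fixes f :: "'w \<Rightarrow> 'a::euclidean_space ^ 'n"
  assumes "\<And>i. integrable M (\<lambda>\<omega>. f \<omega> $ i)"
  shows "integrable M f"
proof -
  have "linear (axis i :: 'a \<Rightarrow> 'a ^ 'n)" for i
    by (auto simp: linear_iff axis_def vec_eq_iff)
  then have bl: "bounded_linear (axis i :: 'a \<Rightarrow> 'a ^ 'n)" for i
    by (rule linear_conv_bounded_linear[THEN iffD1])
  have "integrable M (\<lambda>\<omega>. \<Sum>i\<in>UNIV. axis i (f \<omega> $ i))"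
    by (intro Bochner_Integration.integrable_sum integrable_bounded_linear[OF bl] assms)
  moreover have "(\<Sum>i\<in>UNIV. axis i (f \<omega> $ i)) = f \<omega>" for \<omega>
    by (simp add: vec_eq_iff axis_def)
  ultimately show ?thesis by simp
qed

lemma matrix_entry: "X $ p $ q = axis p 1 \<bullet> (X *v axis q (1 :: real))"
  by (simp add: inner_axis' matrix_vector_mul_component inner_axis)

lemma integrable_matrix_congruence:
  fixes D :: "'w \<Rightarrow> real^'n^'m"
  assumes "sq_integrable M D"
  shows "integrable M (\<lambda>\<omega>. transpose (D \<omega>) ** W ** D \<omega>)"
proof (intro integrable_vec)
  fix p q
  have "(transpose (D \<omega>) ** W ** D \<omega>) $ p $ q = (D \<omega> *v axis p 1) \<bullet> (W *v (D \<omega> *v axis q 1))" for \<omega>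
    by (simp add: matrix_entry[of _ p q] inner_transpose
        flip: matrix_vector_mul_assoc del: transpose_matrix_vector)
  then show "integrable M (\<lambda>\<omega>. (transpose (D \<omega>) ** W ** D \<omega>) $ p $ q)"
    by (simp add: sq_integrable_inner sq_integrable_matrix_vector sq_integrable_matrix_vector_const assms)
qed

lemma bounded_linear_matrix_vector_left: "bounded_linear (\<lambda>D :: real^'n^'m. D *v x)"
  by (rule bounded_bilinear.bounded_linear_left[OF bounded_bilinear_matrix_vector])

lemma bounded_linear_quadratic_form: "bounded_linear (\<lambda>X. x \<bullet> (X *v (x :: real^'n)))"
  using bounded_linear_compose[OF bounded_linear_inner_right[of x] bounded_linear_matrix_vector_left[of x]] .

lemma borel_measurable_linear:
  fixes f :: "'a::euclidean_space \<Rightarrow> 'b::euclidean_space"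
  shows "linear f \<Longrightarrow> f \<in> borel_measurable borel"
  by (intro borel_measurable_continuous_onI linear_continuous_on) (simp add: linear_conv_bounded_linear)

lemma borel_measurable_vec_nth [measurable (raw)]:
  assumes "f \<in> borel_measurable N"
  shows "(\<lambda>\<omega>. (f \<omega> :: real^'n) $ i) \<in> borel_measurable N"
proof -
  have "linear (\<lambda>x :: real^'n. x $ i)" by (simp add: linear_iff)
  from measurable_compose[OF assms borel_measurable_linear[OF this]] show ?thesis .
qed

lemma linear_row_block: "linear (row_block \<sigma> i :: real^'b^'a \<Rightarrow> _)"
  by (auto simp: linear_iff row_block_def vec_eq_iff)

lemma borel_measurable_row_block [measurable]: "row_block \<sigma> i \<in> borel_measurable borel"
  by (rule borel_measurable_linear[OF linear_row_block])

lemma sum_row_block: "(\<Sum>i\<in>UNIV. row_block \<sigma> i X) = (X :: real^'b^'a)" for \<sigma> :: "'a::finite \<Rightarrow> 's::finite"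
  by (simp add: row_block_def vec_eq_iff)

lemma sum_col_block: "(\<Sum>i\<in>UNIV. col_block \<tau> i X) = (X :: real^'b^'a)" for \<tau> :: "'b::finite \<Rightarrow> 's::finite"
  by (simp add: col_block_def vec_eq_iff)

lemma sum_diag_block:
  fixes \<tau> :: "'a::finite \<Rightarrow> 's::finite"
  assumes "block_diagonal \<tau> \<tau> X"
  shows "(\<Sum>i\<in>UNIV. diag_block \<tau> i X) = X"
proof -
  have "(\<Sum>i\<in>UNIV. diag_block \<tau> i X $ p $ q) = X $ p $ q" for p q
  proof (cases "\<tau> p = \<tau> q")
    case True
    then have "diag_block \<tau> i X $ p $ q = (if \<tau> q = i then X $ p $ q else 0)" for i
      by (simp add: diag_block_def)
    then show ?thesis by simp
  next
    case False
    then have "diag_block \<tau> i X $ p $ q = 0" for i by (auto simp: diag_block_def)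
    then show ?thesis using False assms by (simp add: block_diagonal_def)
  qed
  then show ?thesis by (simp add: vec_eq_iff)
qed

lemma matrix_vector_sum_left: "(\<Sum>i\<in>I. D i) *v x = (\<Sum>i\<in>I. D i *v (x :: real^'n))"
  for D :: "'i \<Rightarrow> real^'n^'m"
  by (induction I rule: infinite_finite_induct) (auto simp: matrix_vector_mult_add_rdistrib)

lemma matrix_vector_sum_right: "D *v (\<Sum>i\<in>I. x i) = (\<Sum>i\<in>I. D *v (x i :: real^'n))"
  for D :: "real^'n^'m"
  by (induction I rule: infinite_finite_induct) (auto simp: matrix_vector_right_distrib)

context prob_space
begin

lemma sq_integrable_const: "sq_integrable M (\<lambda>_. c)"
  by (simp add: sq_integrable_def)

lemma sq_integrable_imp_integrable:
  assumes "sq_integrable M f"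
  shows "integrable M f"
proof -
  have "integrable M (\<lambda>\<omega>. 1 + (norm (f \<omega>))\<^sup>2)"
    using assms by (simp add: sq_integrable_def)
  then show ?thesis
  proof (rule Bochner_Integration.integrable_bound, goal_cases)
    case 2
    have "norm (f \<omega>) \<le> 1 + (norm (f \<omega>))\<^sup>2" for \<omega>
      using sum_squares_bound[of 1 "norm (f \<omega>)"] norm_ge_zero[of "f \<omega>"]
      by (simp del: norm_ge_zero)
    then show ?case by simp
  qed (use assms in \<open>simp add: sq_integrable_def\<close>)
qed

text \<open>
  Only one of the two independent vectors needs to be centered.
\<close>

lemma integral_indep_inner_eq_0:
  fixes f g :: "'a \<Rightarrow> real^'n"
  assumes ind: "indep_var borel f borel g"
    and f: "sq_integrable M f" and g: "sq_integrable M g" and f0: "(\<integral>\<omega>. f \<omega> \<partial>M) = 0"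
  shows "(\<integral>\<omega>. f \<omega> \<bullet> (P *v g \<omega>) \<partial>M) = 0"
proof -
  have fi: "integrable M (\<lambda>\<omega>. f \<omega> $ p)" for p
    by (intro integrable_bounded_linear[OF bounded_linear_vec_nth] sq_integrable_imp_integrable f)
  have gi: "integrable M (\<lambda>\<omega>. (P *v g \<omega>) $ p)" for p
    by (intro integrable_bounded_linear[OF bounded_linear_vec_nth] sq_integrable_imp_integrable
        sq_integrable_matrix_vector g)
  have "indep_var borel ((\<lambda>z. z $ p) \<circ> f) borel ((\<lambda>z. (P *v z) $ p) \<circ> g)" for p
    by (rule indep_var_compose[OF ind])
      (auto intro!: borel_measurable_linear simp: linear_iff algebra_simps)
  then have ip: "indep_var borel (\<lambda>\<omega>. f \<omega> $ p) borel (\<lambda>\<omega>. (P *v g \<omega>) $ p)" for p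
    by (simp add: comp_def)
  have "(\<integral>\<omega>. f \<omega> \<bullet> (P *v g \<omega>) \<partial>M) = (\<Sum>p\<in>UNIV. \<integral>\<omega>. f \<omega> $ p * (P *v g \<omega>) $ p \<partial>M)"
    unfolding inner_vec_def inner_real_def
    by (intro Bochner_Integration.integral_sum indep_var_integrable[OF ip fi gi])
  also have "\<dots> = (\<Sum>p\<in>UNIV. (\<integral>\<omega>. f \<omega> $ p \<partial>M) * (\<integral>\<omega>. (P *v g \<omega>) $ p \<partial>M))"
    by (simp add: indep_var_lebesgue_integral[OF ip fi gi])
  also have "\<dots> = 0"
    using integral_bounded_linear[OF bounded_linear_vec_nth sq_integrable_imp_integrable[OF f]] f0
    by simp
  finally show ?thesis .
qed

text \<open>The second moment of a sum of pairwise orthogonal centered vectors about a constant.\<close>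

lemma integral_quadratic_sum_orthogonal:
  fixes z :: "'s::finite \<Rightarrow> 'a \<Rightarrow> real^'n"
  assumes P: "transpose P = P"
    and z: "\<And>i. sq_integrable M (z i)" and z0: "\<And>i. (\<integral>\<omega>. z i \<omega> \<partial>M) = 0"
    and orth: "\<And>i j. i \<noteq> j \<Longrightarrow> (\<integral>\<omega>. z i \<omega> \<bullet> (P *v z j \<omega>) \<partial>M) = 0"
  shows "(\<integral>\<omega>. (m + (\<Sum>i\<in>UNIV. z i \<omega>)) \<bullet> (P *v (m + (\<Sum>i\<in>UNIV. z i \<omega>))) \<partial>M)
    = m \<bullet> (P *v m) + (\<Sum>i\<in>UNIV. \<integral>\<omega>. z i \<omega> \<bullet> (P *v z i \<omega>) \<partial>M)"
proof -
  have zz: "integrable M (\<lambda>\<omega>. z i \<omega> \<bullet> (P *v z j \<omega>))" for i j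
    by (intro sq_integrable_inner sq_integrable_matrix_vector z)
  have zP: "integrable M (\<lambda>\<omega>. m \<bullet> (P *v z i \<omega>))" for i
    by (intro sq_integrable_inner sq_integrable_matrix_vector z sq_integrable_const)
  have zP0: "(\<integral>\<omega>. m \<bullet> (P *v z i \<omega>) \<partial>M) = 0" for i
  proof -
    have "bounded_linear (\<lambda>v. m \<bullet> (P *v v))"
      by (intro bounded_linear_compose[OF bounded_linear_inner_right]
          bounded_bilinear.bounded_linear_right[OF bounded_bilinear_matrix_vector])
    from integral_bounded_linear[OF this sq_integrable_imp_integrable[OF z]] z0
    show ?thesis by simp
  qed
  have "(\<integral>\<omega>. (m + (\<Sum>i\<in>UNIV. z i \<omega>)) \<bullet> (P *v (m + (\<Sum>i\<in>UNIV. z i \<omega>))) \<partial>M)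
    = (\<integral>\<omega>. m \<bullet> (P *v m) + 2 * (\<Sum>i\<in>UNIV. m \<bullet> (P *v z i \<omega>))
        + (\<Sum>i\<in>UNIV. \<Sum>j\<in>UNIV. z i \<omega> \<bullet> (P *v z j \<omega>)) \<partial>M)"
    by (intro Bochner_Integration.integral_cong refl)
      (simp add: quadratic_form_add[OF P] matrix_vector_sum_right inner_sum_left inner_sum_right,
        rule sum.swap)
  also have "\<dots> = m \<bullet> (P *v m) + 2 * (\<Sum>i\<in>UNIV. \<integral>\<omega>. m \<bullet> (P *v z i \<omega>) \<partial>M)
        + (\<Sum>i\<in>UNIV. \<Sum>j\<in>UNIV. \<integral>\<omega>. z i \<omega> \<bullet> (P *v z j \<omega>) \<partial>M)"
    by (simp add: zz zP prob_space)
  also have "(\<Sum>i\<in>UNIV. \<Sum>j\<in>UNIV. \<integral>\<omega>. z i \<omega> \<bullet> (P *v z j \<omega>) \<partial>M)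
      = (\<Sum>i\<in>UNIV. \<Sum>j\<in>UNIV. if i = j then \<integral>\<omega>. z i \<omega> \<bullet> (P *v z i \<omega>) \<partial>M else 0)"
    by (intro sum.cong) (auto simp: orth)
  finally show ?thesis by (simp add: zP0)
qed

end

section \<open>One step of the control problem\<close>

text \<open>
  The system data. The families of block rows, indexed by subsystem and time, are independent,
  and the first and second moments of \<open>A(k)\<close> are the same at all times.
\<close>

locale networked_system = prob_space M
  for M :: "'w measure" +
  fixes \<sigma> :: "'n::finite \<Rightarrow> 's::finite"
    and \<tau> :: "'m::finite \<Rightarrow> 's"
    and A :: "nat \<Rightarrow> 'w \<Rightarrow> real^'n^'n"
    and Abar :: "real^'n^'n"
    and Sig :: "real^('n \<times> 'n)^('n \<times> 'n)"
    and B :: "real^'m^'n"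
    and R :: "real^'m^'m"
  assumes A_measurable [measurable]: "\<And>k. A k \<in> borel_measurable M"
    and A_kronecker: "\<And>k. integrable M (\<lambda>\<omega>. kronecker (A k \<omega>) (A k \<omega>))"
    and indep_rows: "indep_vars (\<lambda>_. borel) (\<lambda>(i, k) \<omega>. row_block \<sigma> i (A k \<omega>)) (UNIV :: ('s \<times> nat) set)"
    and A_mean: "\<And>k. (\<integral>\<omega>. A k \<omega> \<partial>M) = Abar"
    and A_second_moment: "\<And>k. (\<integral>\<omega>. kronecker (A k \<omega>) (A k \<omega>) \<partial>M) = Sig"
    and R_pos: "sym_pos_def R" and R_block: "block_diagonal \<tau> \<tau> R"
begin

lemma kronecker_entry: "kronecker X Y $ (p, r) $ (q, s) = X $ p $ q * Y $ r $ s"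
  by (simp add: kronecker_def)

lemma integrable_entry_product: "integrable M (\<lambda>\<omega>. A k \<omega> $ p $ q * A k \<omega> $ r $ s)"
proof -
  have "integrable M (\<lambda>\<omega>. kronecker (A k \<omega>) (A k \<omega>) $ (p, r) $ (q, s))"
    by (intro integrable_bounded_linear[OF bounded_linear_vec_nth] A_kronecker)
  then show ?thesis by (simp add: kronecker_entry)
qed

lemma sq_integrable_A: "sq_integrable M (A k)"
proof -
  have "(norm X)\<^sup>2 = (\<Sum>p\<in>UNIV. \<Sum>q\<in>UNIV. X $ p $ q * X $ p $ q)" for X :: "real^'n^'n"
    by (simp add: power2_norm_eq_inner inner_vec_def)
  then show ?thesis
    by (simp add: sq_integrable_def integrable_entry_product)
qed

lemma sq_integrable_linear:
  fixes f :: "real^'n^'n \<Rightarrow> 'e::euclidean_space"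
  assumes "linear f" "sq_integrable M g"
  shows "sq_integrable M (\<lambda>\<omega>. f (g \<omega>))"
proof -
  have bl: "bounded_linear f" using assms(1) linear_conv_bounded_linear by blast
  show ?thesis
  proof (rule sq_integrable_dominated[OF assms(2)])
    show "(\<lambda>\<omega>. f (g \<omega>)) \<in> borel_measurable M"
      using measurable_compose[OF sq_integrable_measurable[OF assms(2)] borel_measurable_linear[OF assms(1)]] .
    show "norm (f (g \<omega>)) \<le> onorm f * norm (g \<omega>)" for \<omega>
      by (rule onorm[OF bl])
  qed
qed

lemma centered_A: "centered M (A k) \<omega> = A k \<omega> - Abar"
  by (simp add: centered_def A_mean)

lemma sq_integrable_centered_row: "sq_integrable M (\<lambda>\<omega>. row_block \<sigma> i (centered M (A k) \<omega>))"
  unfolding centered_A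
  by (rule sq_integrable_linear[OF linear_row_block sq_integrable_diff[OF sq_integrable_A sq_integrable_const]])

lemma row_block_centered:
  "row_block \<sigma> i (centered M (A k) \<omega>) = row_block \<sigma> i (A k \<omega>) - row_block \<sigma> i Abar"
  unfolding centered_A by (rule linear_diff[OF linear_row_block])

lemma integral_centered_row: "(\<integral>\<omega>. row_block \<sigma> i (centered M (A k) \<omega>) *v x \<partial>M) = 0"
proof -
  have "linear (\<lambda>X. row_block \<sigma> i X *v x)"
    using linear_compose[OF linear_row_block
        bounded_linear.linear[OF bounded_linear_matrix_vector_left]] by (simp add: comp_def)
  then have bl: "bounded_linear (\<lambda>X :: real^'n^'n. row_block \<sigma> i X *v x)"
    by (simp add: linear_conv_bounded_linear)
  have A: "integrable M (A k)" by (intro sq_integrable_imp_integrable sq_integrable_A)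
  have "(\<integral>\<omega>. A k \<omega> - Abar \<partial>M) = 0" using A by (simp add: A_mean prob_space)
  with integral_bounded_linear[OF bl Bochner_Integration.integrable_diff[OF A, of "\<lambda>_. Abar"]]
  show ?thesis unfolding centered_A by (simp add: linear_0[OF linear_row_block])
qed

text \<open>The block rows at one time, for distinct subsystems.\<close>

lemma indep_row_pair:
  assumes "i \<noteq> j"
  shows "indep_var borel (\<lambda>\<omega>. row_block \<sigma> i (A k \<omega>)) borel (\<lambda>\<omega>. row_block \<sigma> j (A k \<omega>))"
proof -
  have "indep_var borel ((\<lambda>f. f (i, k)) \<circ> (\<lambda>\<omega>. \<lambda>p\<in>{(i, k)}. (case p of (i, k) \<Rightarrow> \<lambda>\<omega>. row_block \<sigma> i (A k \<omega>)) \<omega>))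
      borel ((\<lambda>f. f (j, k)) \<circ> (\<lambda>\<omega>. \<lambda>p\<in>{(j, k)}. (case p of (i, k) \<Rightarrow> \<lambda>\<omega>. row_block \<sigma> i (A k \<omega>)) \<omega>))"
    using assms by (intro indep_var_compose[OF indep_var_restrict[OF indep_rows]]) auto
  then show ?thesis by (simp add: comp_def)
qed

text \<open>
  The right-hand side of the modified Riccati equation without the state weight. It is formed
  with the distribution of \<open>A(k)\<close>, and is shown below not to depend on \<open>k\<close>.
\<close>

definition riccati_map :: "nat \<Rightarrow> real^'n^'n \<Rightarrow> real^'n^'n" where
  "riccati_map k P = riccati Abar P B R
    + (\<Sum>i\<in>UNIV. \<integral>\<omega>. riccati_on {q. \<tau> q = i} (row_block \<sigma> i (centered M (A k) \<omega>)) P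
                          (col_block \<tau> i B) (diag_block \<tau> i R) \<partial>M)"

lemma modified_dare_iff:
  "modified_dare M \<sigma> \<tau> A Abar B Q R k P \<longleftrightarrow> P = Q + riccati_map k P"
  by (simp add: modified_dare_def riccati_map_def add.assoc)

text \<open>
  For subsystem \<open>i\<close>: the zero-padded matrix \<open>R\<^sub>i\<^sub>i + B\<^sub>i\<^sup>T P B\<^sub>i\<close>, and the factor of the optimal gain
  that multiplies the fluctuation of the block row.
\<close>

definition input_hessian :: "real^'n^'n \<Rightarrow> 's \<Rightarrow> real^'m^'m" where
  "input_hessian P i = diag_block \<tau> i R + transpose (col_block \<tau> i B) ** P ** col_block \<tau> i B"

definition block_gain :: "real^'n^'n \<Rightarrow> 's \<Rightarrow> real^'n^'m" where
  "block_gain P i = inv_on {q. \<tau> q = i} (input_hessian P i) ** transpose (col_block \<tau> i B) ** P"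

lemma diag_block_symmetric: "transpose (diag_block \<tau> i R) = diag_block \<tau> i R"
proof -
  have "R $ p $ q = R $ q $ p" for p q
    using R_pos by (auto simp: sym_pos_def_def transpose_def vec_eq_iff)
  then show ?thesis by (auto simp: transpose_def diag_block_def vec_eq_iff)
qed

lemma diag_block_quadratic:
  "v \<bullet> (diag_block \<tau> i R *v v) = (mat_on {q. \<tau> q = i} *v v) \<bullet> (R *v (mat_on {q. \<tau> q = i} *v v))"
proof -
  have "diag_block \<tau> i R *v v = mat_on {q. \<tau> q = i} *v (R *v (mat_on {q. \<tau> q = i} *v v))"
    unfolding mat_on_vector vec_eq_iff
    by (auto simp: diag_block_def matrix_vector_mult_def intro!: sum.cong)
  moreover have "transpose (mat_on {q. \<tau> q = i} :: real^'m^'m) = mat_on {q. \<tau> q = i}"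
    by (auto simp: mat_on_def transpose_def vec_eq_iff)
  ultimately show ?thesis by (metis inner_transpose)
qed

lemma diag_block_nonneg: "0 \<le> v \<bullet> (diag_block \<tau> i R *v v)"
  unfolding diag_block_quadratic
  using sym_pos_semidefD(2)[OF sym_pos_def_imp_semidef[OF R_pos]] .

lemma input_hessian_semidef: "sym_pos_semidef P \<Longrightarrow> sym_pos_semidef (input_hessian P i)"
  unfolding input_hessian_def
  by (intro sym_pos_semidef_add sym_pos_semidef_congruence)
    (simp add: sym_pos_semidef_def diag_block_symmetric diag_block_nonneg)

lemma input_block_subsystem:
  assumes "sym_pos_semidef P"
  shows "input_block {q. \<tau> q = i} (col_block \<tau> i B) (diag_block \<tau> i R) P"
proof
  show "0 < v \<bullet> (diag_block \<tau> i R *v v)"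
    if "v \<noteq> 0" "\<And>q. q \<notin> {q. \<tau> q = i} \<Longrightarrow> v $ q = 0" for v
  proof -
    have "mat_on {q. \<tau> q = i} *v v = v" using that by (auto simp: mat_on_vector vec_eq_iff)
    then show ?thesis using R_pos that(1) by (simp add: diag_block_quadratic sym_pos_def_def)
  qed
  show "transpose (diag_block \<tau> i R) = diag_block \<tau> i R"
    by (rule diag_block_symmetric)
qed (use assms in \<open>auto simp: diag_block_def col_block_def\<close>)

lemma input_block_full:
  assumes "sym_pos_semidef P"
  shows "input_block UNIV B R P"
  using assms R_pos by unfold_locales (auto simp: sym_pos_def_def)

lemma block_completion:
  assumes P: "sym_pos_semidef P"
  shows "v \<bullet> (diag_block \<tau> i R *v v)
      + (D *v x + col_block \<tau> i B *v v) \<bullet> (P *v (D *v x + col_block \<tau> i B *v v))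
    = x \<bullet> (riccati_on {q. \<tau> q = i} D P (col_block \<tau> i B) (diag_block \<tau> i R) *v x)
      + (v + block_gain P i ** D *v x) \<bullet> (input_hessian P i *v (v + block_gain P i ** D *v x))"
  using input_block.riccati_on_completion[OF input_block_subsystem[OF P]]
  by (simp add: input_block.hessian_def[OF input_block_subsystem[OF P]] input_hessian_def block_gain_def)

lemma full_completion:
  assumes P: "sym_pos_semidef P"
  shows "v \<bullet> (R *v v) + (D *v x + B *v v) \<bullet> (P *v (D *v x + B *v v))
    = x \<bullet> (riccati D P B R *v x)
      + (v + matrix_inv (R + transpose B ** P ** B) ** transpose B ** P ** D *v x) \<bullet>
        ((R + transpose B ** P ** B) *v (v + matrix_inv (R + transpose B ** P ** B) ** transpose B ** P ** D *v x))"
  using input_block.riccati_on_completion[OF input_block_full[OF P]]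
  by (simp add: input_block.hessian_def[OF input_block_full[OF P]] inv_on_UNIV riccati_on_UNIV)

lemma integrable_riccati_on:
  "integrable M (\<lambda>\<omega>. riccati_on S (row_block \<sigma> i (centered M (A k) \<omega>)) P Bs Rs)"
  unfolding riccati_on_def by (rule integrable_matrix_congruence[OF sq_integrable_centered_row])

lemma quadratic_riccati_map:
  "x \<bullet> (riccati_map k P *v x) = x \<bullet> (riccati Abar P B R *v x)
    + (\<Sum>i\<in>UNIV. \<integral>\<omega>. x \<bullet> (riccati_on {q. \<tau> q = i} (row_block \<sigma> i (centered M (A k) \<omega>)) P
                          (col_block \<tau> i B) (diag_block \<tau> i R) *v x) \<partial>M)"
  unfolding riccati_map_def
  by (simp add: matrix_vector_mult_add_rdistrib matrix_vector_sum_left inner_add_right inner_sum_right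
      integral_bounded_linear[OF bounded_linear_quadratic_form integrable_riccati_on])

text \<open>
  The input at time \<open>k\<close> of a limited information law with the measured states held fixed:
  the coordinates of subsystem \<open>i\<close> are a function of the \<open>i\<close>-th block row only.
\<close>

definition local_input :: "('s \<Rightarrow> real^'n^'n \<Rightarrow> real^'m) \<Rightarrow> real^'n^'n \<Rightarrow> real^'m" where
  "local_input \<phi> Z = (\<chi> q. \<phi> (\<tau> q) (row_block \<sigma> (\<tau> q) Z) $ q)"

lemma borel_measurable_local_input:
  assumes "\<And>i. \<phi> i \<in> borel_measurable borel"
  shows "local_input \<phi> \<in> borel_measurable borel"
proof -
  have "local_input \<phi> = (\<lambda>Z. \<Sum>q\<in>UNIV. \<phi> (\<tau> q) (row_block \<sigma> (\<tau> q) Z) $ q *\<^sub>R axis q (1 :: real))"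
    by (simp add: fun_eq_iff local_input_def vec_eq_iff axis_def if_distrib cong: if_cong)
  moreover have "\<dots> \<in> borel_measurable borel"
    by (intro borel_measurable_sum borel_measurable_scaleR borel_measurable_const borel_measurable_vec_nth
        measurable_compose[OF borel_measurable_row_block assms])
  ultimately show ?thesis by simp
qed

lemma col_block_local_input:
  "col_block \<tau> i B *v local_input \<phi> Z = col_block \<tau> i B *v \<phi> i (row_block \<sigma> i Z)"
  by (auto simp: col_block_def local_input_def matrix_vector_mult_def vec_eq_iff intro!: sum.cong)

lemma quadratic_R_blocks: "v \<bullet> (R *v v) = (\<Sum>i\<in>UNIV. v \<bullet> (diag_block \<tau> i R *v v))"
  by (subst sum_diag_block[OF R_block, symmetric]) (simp add: matrix_vector_sum_left inner_sum_right)

text \<open>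
  The expected cost of one step exceeds the Riccati form by two kinds of nonnegative terms:
  one for the mean of the input, and one for the fluctuation of each subsystem. The cross terms
  vanish because the fluctuations of distinct subsystems are independent and centered.
\<close>

lemma one_step_identity:
  fixes x :: "real^'n" and k :: nat
  assumes P: "sym_pos_semidef P" and \<phi> [measurable]: "\<And>i. \<phi> i \<in> borel_measurable borel"
  defines "u \<equiv> \<lambda>\<omega>. local_input \<phi> (A k \<omega>)"
  defines "ubar \<equiv> \<integral>\<omega>. u \<omega> \<partial>M"
  assumes u: "sq_integrable M u"
  shows "(\<integral>\<omega>. u \<omega> \<bullet> (R *v u \<omega>) + (A k \<omega> *v x + B *v u \<omega>) \<bullet> (P *v (A k \<omega> *v x + B *v u \<omega>)) \<partial>M)
    = x \<bullet> (riccati_map k P *v x)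
      + (ubar + matrix_inv (R + transpose B ** P ** B) ** transpose B ** P ** Abar *v x) \<bullet>
        ((R + transpose B ** P ** B) *v (ubar + matrix_inv (R + transpose B ** P ** B) ** transpose B ** P ** Abar *v x))
      + (\<Sum>i\<in>UNIV. \<integral>\<omega>.
          (u \<omega> - ubar + block_gain P i ** row_block \<sigma> i (centered M (A k) \<omega>) *v x) \<bullet>
          (input_hessian P i *v (u \<omega> - ubar + block_gain P i ** row_block \<sigma> i (centered M (A k) \<omega>) *v x)) \<partial>M)"
    (is "?lhs = _ + ?mean + (\<Sum>i\<in>UNIV. \<integral>\<omega>. ?dev i \<omega> \<partial>M)")
proof -
  note tP = sym_pos_semidefD(1)[OF P]
  have tR: "transpose R = R" using R_pos by (simp add: sym_pos_def_def)
  define v where "v \<omega> = u \<omega> - ubar" for \<omega>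
  have v: "sq_integrable M v"
    unfolding v_def by (intro sq_integrable_diff u sq_integrable_const)
  have v0: "(\<integral>\<omega>. v \<omega> \<partial>M) = 0"
    using sq_integrable_imp_integrable[OF u] by (simp add: v_def ubar_def prob_space)
  define z where "z i \<omega> = row_block \<sigma> i (centered M (A k) \<omega>) *v x + col_block \<tau> i B *v v \<omega>" for i \<omega>
  have z: "sq_integrable M (z i)" for i
    unfolding z_def
    by (intro sq_integrable_add sq_integrable_matrix_vector sq_integrable_matrix_vector_const
        sq_integrable_centered_row v)
  have z0: "(\<integral>\<omega>. z i \<omega> \<partial>M) = 0" for i
  proof -
    have "(\<integral>\<omega>. col_block \<tau> i B *v v \<omega> \<partial>M) = 0"
      using integral_bounded_linear[OF
          bounded_bilinear.bounded_linear_right[OF bounded_bilinear_matrix_vector]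
          sq_integrable_imp_integrable[OF v], of "col_block \<tau> i B"] v0 by simp
    then show ?thesis
      unfolding z_def
      by (subst Bochner_Integration.integral_add)
        (auto simp: integral_centered_row intro!: sq_integrable_imp_integrable sq_integrable_matrix_vector
          sq_integrable_matrix_vector_const sq_integrable_centered_row v)
  qed
  have orth: "(\<integral>\<omega>. z i \<omega> \<bullet> (P *v z j \<omega>) \<partial>M) = 0" if "i \<noteq> j" for i j
  proof (rule integral_indep_inner_eq_0[OF _ z z z0])
    define \<zeta> where "\<zeta> i Z = (Z - row_block \<sigma> i Abar) *v x + col_block \<tau> i B *v (\<phi> i Z - ubar)" for i Z
    have [measurable]: "\<zeta> i \<in> borel_measurable borel" for i
      unfolding \<zeta>_def by measurable
    have "z i = \<zeta> i \<circ> (\<lambda>\<omega>. row_block \<sigma> i (A k \<omega>))" for i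
      by (simp add: fun_eq_iff z_def \<zeta>_def v_def u_def row_block_centered matrix_vector_mult_diff_distrib
          col_block_local_input)
    then show "indep_var borel (z i) borel (z j)"
      using indep_var_compose[OF indep_row_pair[OF that, of k], of "\<zeta> i" borel "\<zeta> j" borel] by simp
  qed
  define m where "m = Abar *v x + B *v ubar"
  have y: "A k \<omega> *v x + B *v u \<omega> = m + (\<Sum>i\<in>UNIV. z i \<omega>)" for \<omega>
  proof -
    have "(\<Sum>i\<in>UNIV. z i \<omega>) = (A k \<omega> - Abar) *v x + B *v v \<omega>"
      unfolding z_def sum.distrib
      by (simp add: sum_row_block sum_col_block centered_A flip: matrix_vector_sum_left)
    then show ?thesis
      by (simp add: m_def v_def matrix_vector_mult_diff_distrib matrix_vector_mult_diff_rdistrib)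
  qed
  have vR: "integrable M (\<lambda>\<omega>. v \<omega> \<bullet> (diag_block \<tau> i R *v v \<omega>))" for i
    by (intro sq_integrable_quadratic v)
  have zP: "integrable M (\<lambda>\<omega>. z i \<omega> \<bullet> (P *v z i \<omega>))" for i
    by (intro sq_integrable_quadratic z)
  have uR: "integrable M (\<lambda>\<omega>. u \<omega> \<bullet> (R *v u \<omega>))"
    by (intro sq_integrable_quadratic u)
  have yP: "integrable M (\<lambda>\<omega>. (A k \<omega> *v x + B *v u \<omega>) \<bullet> (P *v (A k \<omega> *v x + B *v u \<omega>)))"
    by (intro sq_integrable_quadratic sq_integrable_add sq_integrable_matrix_vector
        sq_integrable_matrix_vector_const sq_integrable_A u)
  have yPy: "(\<integral>\<omega>. (A k \<omega> *v x + B *v u \<omega>) \<bullet> (P *v (A k \<omega> *v x + B *v u \<omega>)) \<partial>M)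
      = m \<bullet> (P *v m) + (\<Sum>i\<in>UNIV. \<integral>\<omega>. z i \<omega> \<bullet> (P *v z i \<omega>) \<partial>M)"
    unfolding y by (rule integral_quadratic_sum_orthogonal[OF tP z z0 orth])
  have "(\<integral>\<omega>. u \<omega> \<bullet> (R *v u \<omega>) \<partial>M) = ubar \<bullet> (R *v ubar) + (\<integral>\<omega>. v \<omega> \<bullet> (R *v v \<omega>) \<partial>M)"
    using integral_quadratic_sum_orthogonal[OF tR, of "\<lambda>_::unit. v" ubar] v v0
    by (simp add: v_def)
  also have "(\<integral>\<omega>. v \<omega> \<bullet> (R *v v \<omega>) \<partial>M) = (\<Sum>i\<in>UNIV. \<integral>\<omega>. v \<omega> \<bullet> (diag_block \<tau> i R *v v \<omega>) \<partial>M)"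
    by (simp add: quadratic_R_blocks vR)
  finally have lhs: "?lhs = (ubar \<bullet> (R *v ubar) + m \<bullet> (P *v m))
      + (\<Sum>i\<in>UNIV. (\<integral>\<omega>. v \<omega> \<bullet> (diag_block \<tau> i R *v v \<omega>) \<partial>M) + (\<integral>\<omega>. z i \<omega> \<bullet> (P *v z i \<omega>) \<partial>M))"
    by (simp add: uR yP yPy sum.distrib)
  have blocks: "(\<integral>\<omega>. v \<omega> \<bullet> (diag_block \<tau> i R *v v \<omega>) \<partial>M) + (\<integral>\<omega>. z i \<omega> \<bullet> (P *v z i \<omega>) \<partial>M)
      = (\<integral>\<omega>. x \<bullet> (riccati_on {q. \<tau> q = i} (row_block \<sigma> i (centered M (A k) \<omega>)) P
                          (col_block \<tau> i B) (diag_block \<tau> i R) *v x) \<partial>M) + (\<integral>\<omega>. ?dev i \<omega> \<partial>M)" for i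
  proof -
    have "(\<integral>\<omega>. v \<omega> \<bullet> (diag_block \<tau> i R *v v \<omega>) \<partial>M) + (\<integral>\<omega>. z i \<omega> \<bullet> (P *v z i \<omega>) \<partial>M)
      = (\<integral>\<omega>. v \<omega> \<bullet> (diag_block \<tau> i R *v v \<omega>) + z i \<omega> \<bullet> (P *v z i \<omega>) \<partial>M)"
      by (simp add: vR zP)
    also have "\<dots> = (\<integral>\<omega>. x \<bullet> (riccati_on {q. \<tau> q = i} (row_block \<sigma> i (centered M (A k) \<omega>)) P
                          (col_block \<tau> i B) (diag_block \<tau> i R) *v x) + ?dev i \<omega> \<partial>M)"
      unfolding z_def block_completion[OF P] v_def ..
    also have "\<dots> = (\<integral>\<omega>. x \<bullet> (riccati_on {q. \<tau> q = i} (row_block \<sigma> i (centered M (A k) \<omega>)) P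
                          (col_block \<tau> i B) (diag_block \<tau> i R) *v x) \<partial>M) + (\<integral>\<omega>. ?dev i \<omega> \<partial>M)"
      using v unfolding v_def
      by (intro Bochner_Integration.integral_add sq_integrable_quadratic sq_integrable_add
          integrable_bounded_linear[OF bounded_linear_quadratic_form integrable_riccati_on])
        (auto simp flip: matrix_vector_mul_assoc intro!: sq_integrable_matrix_vector
          sq_integrable_matrix_vector_const sq_integrable_centered_row)
    finally show ?thesis .
  qed
  show ?thesis
    unfolding lhs blocks m_def
    by (simp add: full_completion[OF P, of ubar Abar x] quadratic_riccati_map sum.distrib)
qed

text \<open>
  The cost of the input \<open>v\<close> in state \<open>x\<close> if the system matrix is \<open>Z\<close> and the next state \<open>y\<close> is
  charged \<open>y \<bullet> P y\<close>.
\<close>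

definition step_cost :: "real^'n^'n \<Rightarrow> real^'n^'n \<Rightarrow> real^'n \<Rightarrow> real^'m \<Rightarrow> real" where
  "step_cost P Z x v = v \<bullet> (R *v v) + (Z *v x + B *v v) \<bullet> (P *v (Z *v x + B *v v))"

lemma R_semidef: "sym_pos_semidef R"
  using R_pos by (rule sym_pos_def_imp_semidef)

lemma step_cost_nonneg: "sym_pos_semidef P \<Longrightarrow> 0 \<le> step_cost P Z x v"
  unfolding step_cost_def by (intro add_nonneg_nonneg sym_pos_semidefD(2) R_semidef)

lemma integrable_step_cost:
  assumes "sq_integrable M u"
  shows "integrable M (\<lambda>\<omega>. step_cost P (A k \<omega>) x (u \<omega>))"
  unfolding step_cost_def
  by (intro Bochner_Integration.integrable_add sq_integrable_quadratic sq_integrable_add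
      sq_integrable_matrix_vector sq_integrable_matrix_vector_const sq_integrable_A assms)

text \<open>
  Inputs with infinite second moment satisfy the bound too: their cost is infinite because
  \<open>R\<close> is positive definite.
\<close>

lemma one_step_ge:
  assumes P: "sym_pos_semidef P" and \<phi>: "\<And>i. \<phi> i \<in> borel_measurable borel"
  shows "ennreal (x \<bullet> (riccati_map k P *v x))
    \<le> (\<integral>\<^sup>+\<omega>. ennreal (step_cost P (A k \<omega>) x (local_input \<phi> (A k \<omega>))) \<partial>M)"
proof (cases "sq_integrable M (\<lambda>\<omega>. local_input \<phi> (A k \<omega>))")
  case True
  have H: "sym_pos_semidef (R + transpose B ** P ** B)"
    by (intro sym_pos_semidef_add sym_pos_semidef_congruence R_semidef P)
  have "x \<bullet> (riccati_map k P *v x) \<le> (\<integral>\<omega>. step_cost P (A k \<omega>) x (local_input \<phi> (A k \<omega>)) \<partial>M)"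
    unfolding step_cost_def one_step_identity[OF P \<phi> True]
    using sym_pos_semidefD(2)[OF H]
    by (intro order_trans[OF _ add_increasing2[OF sum_nonneg order_refl]]
        Bochner_Integration.integral_nonneg sym_pos_semidefD(2)[OF input_hessian_semidef[OF P]]) simp
  then show ?thesis
    using nn_integral_eq_integral[OF integrable_step_cost[OF True, of P k x]]
    by (simp add: step_cost_nonneg[OF P] ennreal_leI)
next
  case False
  define u where "u \<omega> = local_input \<phi> (A k \<omega>)" for \<omega>
  have [measurable]: "u \<in> borel_measurable M"
    unfolding u_def by (rule measurable_compose[OF A_measurable borel_measurable_local_input[OF \<phi>]])
  obtain c where c: "0 < c" "\<And>v. c * (v \<bullet> v) \<le> v \<bullet> (R *v v)"
    using sym_pos_def_lower_bound[OF R_pos] by blast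
  have "(\<integral>\<^sup>+\<omega>. ennreal ((norm (u \<omega>))\<^sup>2) \<partial>M) = \<infinity>"
  proof (rule ccontr)
    assume "\<not> ?thesis"
    then have "integrable M (\<lambda>\<omega>. (norm (u \<omega>))\<^sup>2)"
      by (intro integrableI_nonneg) (auto simp: top.not_eq_extremum)
    with False show False by (simp add: sq_integrable_def flip: u_def)
  qed
  then have "\<infinity> = ennreal c * (\<integral>\<^sup>+\<omega>. ennreal ((norm (u \<omega>))\<^sup>2) \<partial>M)"
    using c(1) by (simp add: ennreal_mult_top)
  also have "\<dots> = (\<integral>\<^sup>+\<omega>. ennreal (c * (u \<omega> \<bullet> u \<omega>)) \<partial>M)"
    using c(1) by (subst nn_integral_cmult[symmetric]) (auto simp: ennreal_mult power2_norm_eq_inner)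
  also have "\<dots> \<le> (\<integral>\<^sup>+\<omega>. ennreal (step_cost P (A k \<omega>) x (u \<omega>)) \<partial>M)"
    unfolding step_cost_def
    by (intro nn_integral_mono ennreal_leI add_increasing2 sym_pos_semidefD(2)[OF P] c(2))
  finally show ?thesis by (simp add: u_def top_unique)
qed

section \<open>The optimal feedback\<close>

text \<open>
  The map from the block row to the input by which subsystem \<open>i\<close> realizes the optimal feedback
  in state \<open>x\<close>; only the coordinates of subsystem \<open>i\<close> are used.
\<close>

definition optimal_local :: "real^'n^'n \<Rightarrow> real^'n \<Rightarrow> 's \<Rightarrow> real^'n^'n \<Rightarrow> real^'m" where
  "optimal_local P x i Z = - (matrix_inv (R + transpose B ** P ** B) ** transpose B ** P ** Abar *v x)
     - block_gain P i ** (Z - row_block \<sigma> i Abar) *v x"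

lemma stack_blocks_vector: "(stack_blocks \<tau> G *v x) $ q = (G (\<tau> q) *v x) $ q"
  by (simp add: stack_blocks_def matrix_vector_mult_def)

lemma optimal_feedback_eq:
  "optimal_feedback M \<sigma> \<tau> A Abar B R P k \<omega> x = local_input (optimal_local P x) (A k \<omega>)"
  unfolding vec_eq_iff
  by (simp add: optimal_feedback_def local_input_def optimal_local_def stack_blocks_vector
      block_gain_def input_hessian_def row_block_centered)

lemma sum_blocks_nth:
  "(\<Sum>i\<in>UNIV. mat_on {q. \<tau> q = i} *v g i) $ q = g (\<tau> q) $ q"
  by (simp add: mat_on_vector)

text \<open>
  As a sum over the subsystems, the optimal feedback is an affine function of the centered rows.
\<close>

lemma optimal_feedback_sum:
  "optimal_feedback M \<sigma> \<tau> A Abar B R P k \<omega> x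
    = - (matrix_inv (R + transpose B ** P ** B) ** transpose B ** P ** Abar *v x)
      - (\<Sum>i\<in>UNIV. mat_on {q. \<tau> q = i} *v (block_gain P i *v (row_block \<sigma> i (centered M (A k) \<omega>) *v x)))"
  unfolding vec_eq_iff vector_minus_component sum_blocks_nth
  by (simp add: optimal_feedback_def stack_blocks_vector block_gain_def input_hessian_def
      matrix_vector_mul_assoc)

lemma sq_integrable_sum:
  assumes "\<And>i. i \<in> I \<Longrightarrow> sq_integrable M (f i)"
  shows "sq_integrable M (\<lambda>\<omega>. \<Sum>i\<in>I. f i \<omega>)"
  using assms
  by (induction I rule: infinite_finite_induct) (auto intro: sq_integrable_add sq_integrable_const)

lemma sq_integrable_optimal_feedback:
  "sq_integrable M (\<lambda>\<omega>. optimal_feedback M \<sigma> \<tau> A Abar B R P k \<omega> x)"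
  unfolding optimal_feedback_sum
  by (intro sq_integrable_diff sq_integrable_const sq_integrable_sum sq_integrable_matrix_vector
      sq_integrable_matrix_vector_const sq_integrable_centered_row)

lemma integral_optimal_feedback:
  "(\<integral>\<omega>. optimal_feedback M \<sigma> \<tau> A Abar B R P k \<omega> x \<partial>M)
    = - (matrix_inv (R + transpose B ** P ** B) ** transpose B ** P ** Abar *v x)"
proof -
  have g: "sq_integrable M (\<lambda>\<omega>. row_block \<sigma> i (centered M (A k) \<omega>) *v x)" for i
    by (intro sq_integrable_matrix_vector_const sq_integrable_centered_row)
  have 0: "(\<integral>\<omega>. mat_on {q. \<tau> q = i} *v (block_gain P i *v (row_block \<sigma> i (centered M (A k) \<omega>) *v x)) \<partial>M) = 0" for i
    unfolding matrix_vector_mul_assoc[of "mat_on {q. \<tau> q = i}"]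
    using integral_bounded_linear[OF
        bounded_bilinear.bounded_linear_right[OF bounded_bilinear_matrix_vector]
        sq_integrable_imp_integrable[OF g], of "mat_on {q. \<tau> q = i} ** block_gain P i" i]
    by (simp add: integral_centered_row)
  have int: "integrable M (\<lambda>\<omega>. mat_on {q. \<tau> q = i} *v (block_gain P i *v (row_block \<sigma> i (centered M (A k) \<omega>) *v x)))" for i
    by (intro sq_integrable_imp_integrable sq_integrable_matrix_vector g)
  show ?thesis
    unfolding optimal_feedback_sum
    by (subst Bochner_Integration.integral_diff) (auto simp: int 0 prob_space)
qed

text \<open>
  The Hessian of subsystem \<open>i\<close> only sees the coordinates of subsystem \<open>i\<close>. So the fluctuation
  terms of the optimal input vanish although its other coordinates are nonzero.
\<close>

lemma input_hessian_mat_on: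
  assumes P: "sym_pos_semidef P"
  shows "input_hessian P i *v v = input_hessian P i *v (mat_on {q. \<tau> q = i} *v v)"
proof -
  have "input_hessian P i ** mat_on {q. \<tau> q = i} = input_hessian P i"
    using input_block.hessian_pad[OF input_block_subsystem[OF P]]
    by (intro mat_on_mult_right)
      (simp add: input_hessian_def input_block.hessian_def[OF input_block_subsystem[OF P]])
  then show ?thesis by (simp add: matrix_vector_mul_assoc)
qed

lemma borel_measurable_optimal_local: "optimal_local P x i \<in> borel_measurable borel"
proof -
  have "optimal_local P x i
      = (\<lambda>Z. - (matrix_inv (R + transpose B ** P ** B) ** transpose B ** P ** Abar *v x)
          - block_gain P i *v ((Z - row_block \<sigma> i Abar) *v x))"
    by (rule ext) (simp only: optimal_local_def matrix_vector_mul_assoc)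
  moreover have "\<dots> \<in> borel_measurable borel"
    by measurable
  ultimately show ?thesis by simp
qed

text \<open>
  All excess terms of \<open>one_step_identity\<close> are zero for the optimal feedback.
\<close>

lemma integral_step_cost_optimal:
  assumes P: "sym_pos_semidef P"
  shows "(\<integral>\<omega>. step_cost P (A k \<omega>) x (optimal_feedback M \<sigma> \<tau> A Abar B R P k \<omega> x) \<partial>M)
    = x \<bullet> (riccati_map k P *v x)"
proof -
  let ?u = "\<lambda>\<omega>. optimal_feedback M \<sigma> \<tau> A Abar B R P k \<omega> x"
  let ?g = "\<lambda>i \<omega>. block_gain P i ** row_block \<sigma> i (centered M (A k) \<omega>) *v x"
  have u: "sq_integrable M (\<lambda>\<omega>. local_input (optimal_local P x) (A k \<omega>))"
    using sq_integrable_optimal_feedback by (simp add: optimal_feedback_eq)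
  have dev: "input_hessian P i *v (?u \<omega> - (\<integral>\<omega>. ?u \<omega> \<partial>M) + ?g i \<omega>) = 0" for i \<omega>
  proof -
    have "(mat_on {q. \<tau> q = i} *v (?u \<omega> - (\<integral>\<omega>. ?u \<omega> \<partial>M) + ?g i \<omega>)) $ q = 0" for q
      unfolding integral_optimal_feedback
      by (simp add: mat_on_vector optimal_feedback_def stack_blocks_vector block_gain_def input_hessian_def)
    then have "mat_on {q. \<tau> q = i} *v (?u \<omega> - (\<integral>\<omega>. ?u \<omega> \<partial>M) + ?g i \<omega>) = 0"
      by (simp add: vec_eq_iff)
    then show ?thesis by (subst input_hessian_mat_on[OF P]) simp
  qed
  show ?thesis
    using one_step_identity[OF P borel_measurable_optimal_local u, of x]
    unfolding optimal_feedback_eq[symmetric] dev step_cost_def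
    by (simp add: integral_optimal_feedback)
qed

lemma one_step_optimal:
  assumes P: "sym_pos_semidef P"
  shows "(\<integral>\<^sup>+\<omega>. ennreal (step_cost P (A k \<omega>) x (optimal_feedback M \<sigma> \<tau> A Abar B R P k \<omega> x)) \<partial>M)
    = ennreal (x \<bullet> (riccati_map k P *v x))"
  using nn_integral_eq_integral[OF integrable_step_cost[OF sq_integrable_optimal_feedback]]
  by (simp add: step_cost_nonneg[OF P] integral_step_cost_optimal[OF P])

section \<open>The Riccati map depends on first and second moments only\<close>

lemma second_moment_form:
  "(\<integral>\<omega>. (A k \<omega> *v x) \<bullet> (W *v (A k \<omega> *v y)) \<partial>M)
    = (\<Sum>p\<in>UNIV. \<Sum>r\<in>UNIV. \<Sum>q\<in>UNIV. \<Sum>s\<in>UNIV. W $ p $ r * x $ q * y $ s * Sig $ (p, r) $ (q, s))"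
proof -
  have "(X *v x) \<bullet> (W *v (X *v y))
      = (\<Sum>p\<in>UNIV. \<Sum>r\<in>UNIV. \<Sum>q\<in>UNIV. \<Sum>s\<in>UNIV. W $ p $ r * x $ q * y $ s * (X $ p $ q * X $ r $ s))"
    for X :: "real^'n^'n"
    by (simp add: inner_vec_def matrix_vector_mult_def sum_distrib_left sum_distrib_right mult_ac,
        rule sum.cong, rule refl, rule sum.cong, rule refl, rule sum.swap)
  moreover have "(\<integral>\<omega>. A k \<omega> $ p $ q * A k \<omega> $ r $ s \<partial>M) = Sig $ (p, r) $ (q, s)" for p q r s
  proof -
    have 1: "integrable M (\<lambda>\<omega>. kronecker (A k \<omega>) (A k \<omega>) $ (p, r))"
      by (intro integrable_bounded_linear[OF bounded_linear_vec_nth] A_kronecker)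
    show ?thesis
      using integral_bounded_linear[OF bounded_linear_vec_nth A_kronecker[of k], of "(p, r)"]
        integral_bounded_linear[OF bounded_linear_vec_nth 1, of "(q, s)"]
      by (simp add: A_second_moment kronecker_entry)
  qed
  ultimately show ?thesis by (simp add: integrable_entry_product)
qed

lemma integral_A_vector: "(\<integral>\<omega>. A k \<omega> *v x \<partial>M) = Abar *v x"
  using integral_bounded_linear[OF bounded_linear_matrix_vector_left
      sq_integrable_imp_integrable[OF sq_integrable_A], of k x]
  by (simp add: A_mean)

lemma centered_form_time_invariant:
  "(\<integral>\<omega>. ((A k \<omega> - Abar) *v x) \<bullet> (W *v ((A k \<omega> - Abar) *v y)) \<partial>M)
    = (\<integral>\<omega>. ((A l \<omega> - Abar) *v x) \<bullet> (W *v ((A l \<omega> - Abar) *v y)) \<partial>M)"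
proof -
  have "(\<integral>\<omega>. ((A k \<omega> - Abar) *v x) \<bullet> (W *v ((A k \<omega> - Abar) *v y)) \<partial>M)
      = (\<integral>\<omega>. (A k \<omega> *v x) \<bullet> (W *v (A k \<omega> *v y)) \<partial>M) - (Abar *v x) \<bullet> (W *v (Abar *v y))" for k
  proof -
    have sq: "sq_integrable M (\<lambda>\<omega>. A k \<omega> *v z)" for z
      by (intro sq_integrable_matrix_vector_const sq_integrable_A)
    have i1: "integrable M (\<lambda>\<omega>. (A k \<omega> *v x) \<bullet> (W *v (A k \<omega> *v y)))"
      "integrable M (\<lambda>\<omega>. (A k \<omega> *v x) \<bullet> (W *v (Abar *v y)))"
      "integrable M (\<lambda>\<omega>. (Abar *v x) \<bullet> (W *v (A k \<omega> *v y)))"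
      by (intro sq_integrable_inner sq_integrable_matrix_vector sq sq_integrable_const)+
    have i2: "(\<integral>\<omega>. (A k \<omega> *v x) \<bullet> (W *v (Abar *v y)) \<partial>M) = (Abar *v x) \<bullet> (W *v (Abar *v y))"
      using integral_bounded_linear[OF bounded_linear_inner_left sq_integrable_imp_integrable[OF sq]]
      by (simp add: integral_A_vector)
    have i3: "(\<integral>\<omega>. (Abar *v x) \<bullet> (W *v (A k \<omega> *v y)) \<partial>M) = (Abar *v x) \<bullet> (W *v (Abar *v y))"
    proof -
      have "bounded_linear (\<lambda>z. (Abar *v x) \<bullet> (W *v z))"
        by (intro bounded_linear_compose[OF bounded_linear_inner_right]
            bounded_bilinear.bounded_linear_right[OF bounded_bilinear_matrix_vector])
      from integral_bounded_linear[OF this sq_integrable_imp_integrable[OF sq]]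
      show ?thesis by (simp add: integral_A_vector)
    qed
    have "((A k \<omega> - Abar) *v x) \<bullet> (W *v ((A k \<omega> - Abar) *v y))
      = (A k \<omega> *v x) \<bullet> (W *v (A k \<omega> *v y)) - (A k \<omega> *v x) \<bullet> (W *v (Abar *v y))
        - (Abar *v x) \<bullet> (W *v (A k \<omega> *v y)) + (Abar *v x) \<bullet> (W *v (Abar *v y))" for \<omega>
      by (simp add: matrix_vector_mult_diff_rdistrib matrix_vector_mult_diff_distrib
          inner_diff_left inner_diff_right)
    then show ?thesis by (simp add: i1 i2 i3 prob_space)
  qed
  then show ?thesis by (simp add: second_moment_form)
qed

lemma riccati_on_entry:
  "(\<integral>\<omega>. riccati_on S (row_block \<sigma> i (centered M (A k) \<omega>)) P Bs Rs \<partial>M) $ p $ q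
    = (\<integral>\<omega>. riccati_on S (row_block \<sigma> i (centered M (A k) \<omega>)) P Bs Rs $ p $ q \<partial>M)"
proof -
  note i = integrable_riccati_on[of S i k P Bs Rs]
  show ?thesis
    using integral_bounded_linear[OF bounded_linear_vec_nth i, of p]
      integral_bounded_linear[OF bounded_linear_vec_nth integrable_bounded_linear[OF bounded_linear_vec_nth i],
        of p q]
    by simp
qed

lemma riccati_map_time_invariant: "riccati_map k P = riccati_map l P"
proof -
  have "(\<integral>\<omega>. riccati_on S (row_block \<sigma> i (centered M (A k) \<omega>)) P Bs Rs \<partial>M)
      = (\<integral>\<omega>. riccati_on S (row_block \<sigma> i (centered M (A l) \<omega>)) P Bs Rs \<partial>M)" for S i Bs and Rs :: "real^'m^'m"
  proof -
    \<comment> \<open>absorb the row selection into the weight, so that only the full matrix \<open>A(k)\<close> remains\<close>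
    define E :: "real^'n^'n" where "E = mat_on {p. \<sigma> p = i}"
    define W where "W = E ** (P - P ** Bs ** inv_on S (Rs + transpose Bs ** P ** Bs) ** transpose Bs ** P) ** E"
    have tE: "transpose E = E" by (auto simp: E_def mat_on_def transpose_def vec_eq_iff)
    have row: "row_block \<sigma> i X = E ** X" for X
      by (simp add: row_block_def E_def mat_on_def matrix_matrix_mult_def vec_eq_iff if_distrib[of "\<lambda>x. x * _"]
          cong: if_cong)
    have "riccati_on S (row_block \<sigma> i X) P Bs Rs = transpose X ** W ** X" for X
      by (simp add: riccati_on_def row W_def matrix_transpose_mul tE matrix_mul_assoc)
    then have "riccati_on S (row_block \<sigma> i X) P Bs Rs $ p $ q = (X *v axis p 1) \<bullet> (W *v (X *v axis q 1))" for X p q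
      by (simp add: matrix_entry[of _ p q] inner_transpose
        flip: matrix_vector_mul_assoc del: transpose_matrix_vector)
    then show ?thesis
      unfolding vec_eq_iff riccati_on_entry
      using centered_form_time_invariant[of k _ W _ l] by (simp add: centered_A)
  qed
  then show ?thesis unfolding riccati_map_def by simp
qed

lemma riccati_map_semidef:
  assumes P: "sym_pos_semidef P"
  shows "sym_pos_semidef (riccati_map k P)"
  unfolding sym_pos_semidef_def
proof (intro conjI allI)
  have "riccati_on {q. \<tau> q = i} D P (col_block \<tau> i B) (diag_block \<tau> i R) $ p $ q
      = riccati_on {q. \<tau> q = i} D P (col_block \<tau> i B) (diag_block \<tau> i R) $ q $ p" for i D p q
    using arg_cong[OF input_block.riccati_on_symmetric[OF input_block_subsystem[OF P], of i D], of "\<lambda>X. X $ q $ p"]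
    by (simp add: transpose_def)
  then have "transpose (\<integral>\<omega>. riccati_on {q. \<tau> q = i} (row_block \<sigma> i (centered M (A k) \<omega>)) P
        (col_block \<tau> i B) (diag_block \<tau> i R) \<partial>M)
      = (\<integral>\<omega>. riccati_on {q. \<tau> q = i} (row_block \<sigma> i (centered M (A k) \<omega>)) P
        (col_block \<tau> i B) (diag_block \<tau> i R) \<partial>M)" for i
    by (simp add: transpose_def vec_eq_iff riccati_on_entry)
  moreover have "transpose (\<Sum>i\<in>UNIV. X i) = (\<Sum>i\<in>UNIV. transpose (X i))" for X :: "'s \<Rightarrow> real^'n^'n"
    by (simp add: transpose_def vec_eq_iff)
  moreover have "transpose (riccati Abar P B R) = riccati Abar P B R"
    using input_block.riccati_on_symmetric[OF input_block_full[OF P]] by (simp add: riccati_on_UNIV)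
  ultimately show "transpose (riccati_map k P) = riccati_map k P"
    by (simp add: riccati_map_def transpose_add)
  fix x
  show "0 \<le> x \<bullet> (riccati_map k P *v x)"
    unfolding integral_step_cost_optimal[OF P, symmetric]
    by (intro Bochner_Integration.integral_nonneg step_cost_nonneg P)
qed


section \<open>The controlled process\<close>

text \<open>
  The input process \<open>u\<close> is generated from \<open>x0\<close> by the limited information law \<open>\<psi>\<close>.
\<close>

definition generates ::
    "(nat \<Rightarrow> 's \<Rightarrow> (real^'n^'n) \<times> (nat \<Rightarrow> real^'n) \<Rightarrow> real^'m) \<Rightarrow> real^'n
      \<Rightarrow> (nat \<Rightarrow> 'w \<Rightarrow> real^'m) \<Rightarrow> bool" where
  "generates \<psi> x0 u \<longleftrightarrow>
     (\<forall>k i. \<psi> k i \<in> borel_measurable (borel \<Otimes>\<^sub>M (\<Pi>\<^sub>M j\<in>{..k}. borel))) \<and>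
     (\<forall>k. \<forall>\<omega>\<in>space M.
        u k \<omega> = local_input (\<lambda>i Z. \<psi> k i (Z, \<lambda>j\<in>{..k}. state A B x0 u j \<omega>)) (A k \<omega>))"

lemma limited_info_inputs_iff:
  "u \<in> limited_info_inputs M \<sigma> \<tau> A B x0 \<longleftrightarrow> (\<exists>\<psi>. generates \<psi> x0 u)"
  by (simp add: limited_info_inputs_def generates_def local_input_def vec_eq_iff)

text \<open>
  The states up to time \<open>k\<close> as a function of the matrices: this exhibits them as a measurable
  function of the block rows before time \<open>k\<close>.
\<close>

primrec history ::
    "(nat \<Rightarrow> 's \<Rightarrow> (real^'n^'n) \<times> (nat \<Rightarrow> real^'n) \<Rightarrow> real^'m) \<Rightarrow> real^'n \<Rightarrow> nat
      \<Rightarrow> (nat \<Rightarrow> real^'n^'n) \<Rightarrow> nat \<Rightarrow> real^'n" where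
  "history \<psi> x0 0 Z = (\<lambda>j\<in>{..0}. x0)"
| "history \<psi> x0 (Suc k) Z = (let h = history \<psi> x0 k Z in
     h(Suc k := Z k *v h k + B *v local_input (\<lambda>i Y. \<psi> k i (Y, h)) (Z k)))"

lemma history_cong: "(\<And>j. j < k \<Longrightarrow> Z j = Z' j) \<Longrightarrow> history \<psi> x0 k Z = history \<psi> x0 k Z'"
  by (induction k) (simp_all add: Let_def)

lemma history_eq_state:
  assumes "generates \<psi> x0 u" "\<omega> \<in> space M"
  shows "history \<psi> x0 k (\<lambda>j. A j \<omega>) = (\<lambda>j\<in>{..k}. state A B x0 u j \<omega>)"
proof (induction k)
  case (Suc k)
  have "u k \<omega> = local_input (\<lambda>i Z. \<psi> k i (Z, \<lambda>j\<in>{..k}. state A B x0 u j \<omega>)) (A k \<omega>)"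
    using assms by (simp add: generates_def)
  then show ?case
    unfolding history.simps Let_def Suc by (auto simp: fun_eq_iff)
qed (auto simp: fun_eq_iff)

lemma measurable_local_input_pair:
  assumes \<psi>: "\<And>i. \<psi> i \<in> borel_measurable (borel \<Otimes>\<^sub>M N)"
    and Z: "Z \<in> borel_measurable N'" and h: "h \<in> measurable N' N"
  shows "(\<lambda>x. local_input (\<lambda>i Y. \<psi> i (Y, h x)) (Z x)) \<in> borel_measurable N'"
proof -
  have "(\<lambda>x. \<psi> i (row_block \<sigma> i (Z x), h x)) \<in> borel_measurable N'" for i
    by (rule measurable_compose[OF measurable_Pair[OF measurable_compose[OF Z borel_measurable_row_block] h] \<psi>])
  then have "(\<lambda>x. \<Sum>q\<in>UNIV. \<psi> (\<tau> q) (row_block \<sigma> (\<tau> q) (Z x), h x) $ q *\<^sub>R axis q (1 :: real)) \<in> borel_measurable N'"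
    by (intro borel_measurable_sum borel_measurable_scaleR borel_measurable_const borel_measurable_vec_nth)
  moreover have "local_input (\<lambda>i Y. \<psi> i (Y, h x)) (Z x)
      = (\<Sum>q\<in>UNIV. \<psi> (\<tau> q) (row_block \<sigma> (\<tau> q) (Z x), h x) $ q *\<^sub>R axis q (1 :: real))" for x
    by (simp add: local_input_def vec_eq_iff axis_def if_distrib cong: if_cong)
  ultimately show ?thesis by simp
qed

lemma measurable_history:
  assumes \<psi>: "\<And>k i. \<psi> k i \<in> borel_measurable (borel \<Otimes>\<^sub>M (\<Pi>\<^sub>M j\<in>{..k}. borel))" and "k \<le> K"
    and Z: "\<And>j. j < K \<Longrightarrow> Z j \<in> borel_measurable N"
  shows "(\<lambda>x. history \<psi> x0 k (\<lambda>j. Z j x)) \<in> measurable N (\<Pi>\<^sub>M j\<in>{..k}. borel)"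
  using \<open>k \<le> K\<close>
proof (induction k)
  case 0
  show ?case unfolding history.simps by (rule measurable_restrict) simp
next
  case (Suc k)
  then have IH: "(\<lambda>x. history \<psi> x0 k (\<lambda>j. Z j x)) \<in> measurable N (\<Pi>\<^sub>M j\<in>{..k}. borel)"
    and Zk: "Z k \<in> borel_measurable N" using Z by auto
  have "(\<lambda>x. history \<psi> x0 k (\<lambda>j. Z j x) k) \<in> borel_measurable N"
    by (rule measurable_compose[OF IH measurable_component_singleton]) simp
  then have "(\<lambda>x. Z k x *v history \<psi> x0 k (\<lambda>j. Z j x) k
      + B *v local_input (\<lambda>i Y. \<psi> k i (Y, history \<psi> x0 k (\<lambda>j. Z j x))) (Z k x)) \<in> borel_measurable N"
    by (intro borel_measurable_add borel_measurable_matrix_vector borel_measurable_const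
        measurable_local_input_pair[OF \<psi> Zk IH] Zk)
  then show ?case
    unfolding history.simps Let_def by (intro measurable_fun_upd[OF _ IH]) (auto simp: atMost_Suc)
qed

text \<open>The matrix at time \<open>k\<close> is independent of the states up to time \<open>k\<close>.\<close>

lemma nn_integral_past_present:
  assumes gen: "generates \<psi> x0 u"
    and g: "g \<in> borel_measurable ((\<Pi>\<^sub>M j\<in>{..k}. borel) \<Otimes>\<^sub>M borel)"
  shows "(\<integral>\<^sup>+\<omega>. g (\<lambda>j\<in>{..k}. state A B x0 u j \<omega>, A k \<omega>) \<partial>M)
    = (\<integral>\<^sup>+\<omega>'. \<integral>\<^sup>+\<omega>. g (\<lambda>j\<in>{..k}. state A B x0 u j \<omega>', A k \<omega>) \<partial>M \<partial>M)"
proof -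
  have \<psi>: "\<psi> k i \<in> borel_measurable (borel \<Otimes>\<^sub>M (\<Pi>\<^sub>M j\<in>{..k}. borel))" for k i
    using gen by (simp add: generates_def)
  \<comment> \<open>split the independent family into the rows before time \<open>k\<close> and the rows at time \<open>k\<close>\<close>
  define rows where "rows = (\<lambda>(i, k) \<omega>. row_block \<sigma> i (A k \<omega>))"
  define I where "I = (UNIV :: 's set) \<times> {..<k}"
  define J where "J = (UNIV :: 's set) \<times> {k}"
  define X where "X \<omega> = (\<lambda>p\<in>I. rows p \<omega>)" for \<omega>
  define Y where "Y \<omega> = (\<lambda>p\<in>J. rows p \<omega>)" for \<omega>
  let ?I = "\<Pi>\<^sub>M p\<in>I. borel :: (real^'n^'n) measure" and ?J = "\<Pi>\<^sub>M p\<in>J. borel :: (real^'n^'n) measure"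
  have ind: "indep_var ?I X ?J Y"
    unfolding X_def Y_def
    by (rule indep_var_restrict[OF indep_rows[folded rows_def]]) (auto simp: I_def J_def)
  then have [measurable]: "X \<in> measurable M ?I" "Y \<in> measurable M ?J"
    and prod: "distr M ?I X \<Otimes>\<^sub>M distr M ?J Y = distr M (?I \<Otimes>\<^sub>M ?J) (\<lambda>\<omega>. (X \<omega>, Y \<omega>))"
    by (auto simp: indep_var_distribution_eq)
  define past where "past f = history \<psi> x0 k (\<lambda>j. \<Sum>i\<in>UNIV. f (i, j))" for f :: "'s \<times> nat \<Rightarrow> real^'n^'n"
  define now where "now f = (\<Sum>i\<in>UNIV. f (i, k))" for f :: "'s \<times> nat \<Rightarrow> real^'n^'n"
  have [measurable]: "past \<in> measurable ?I (\<Pi>\<^sub>M j\<in>{..k}. borel)"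
    unfolding past_def
    by (rule measurable_history[OF \<psi> order_refl])
      (auto intro!: borel_measurable_sum measurable_component_singleton simp: I_def)
  have [measurable]: "now \<in> borel_measurable ?J"
    unfolding now_def
    by (auto intro!: borel_measurable_sum measurable_component_singleton simp: J_def)
  have past: "past (X \<omega>) = (\<lambda>j\<in>{..k}. state A B x0 u j \<omega>)" if "\<omega> \<in> space M" for \<omega>
    unfolding past_def history_eq_state[OF gen that, symmetric]
    by (rule history_cong) (simp add: X_def I_def rows_def sum_row_block)
  have now: "now (Y \<omega>) = A k \<omega>" for \<omega>
    by (simp add: now_def Y_def J_def rows_def sum_row_block)
  note [measurable] = g
  interpret X: prob_space "distr M ?I X" by (rule prob_space_distr) measurable
  interpret Y: prob_space "distr M ?J Y" by (rule prob_space_distr) measurable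
  have "(\<integral>\<^sup>+\<omega>. g (\<lambda>j\<in>{..k}. state A B x0 u j \<omega>, A k \<omega>) \<partial>M) = (\<integral>\<^sup>+\<omega>. g (past (X \<omega>), now (Y \<omega>)) \<partial>M)"
    by (intro nn_integral_cong) (simp add: past now)
  also have "\<dots> = (\<integral>\<^sup>+z. g (past (fst z), now (snd z)) \<partial>distr M (?I \<Otimes>\<^sub>M ?J) (\<lambda>\<omega>. (X \<omega>, Y \<omega>)))"
    by (subst nn_integral_distr) simp_all
  also have "\<dots> = (\<integral>\<^sup>+f. \<integral>\<^sup>+f'. g (past f, now f') \<partial>distr M ?J Y \<partial>distr M ?I X)"
    unfolding prod[symmetric] by (subst Y.nn_integral_fst[symmetric]) simp_all
  also have "\<dots> = (\<integral>\<^sup>+\<omega>'. \<integral>\<^sup>+f'. g (past (X \<omega>'), now f') \<partial>distr M ?J Y \<partial>M)"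
    by (subst nn_integral_distr) simp_all
  also have "\<dots> = (\<integral>\<^sup>+\<omega>'. \<integral>\<^sup>+\<omega>. g (past (X \<omega>'), now (Y \<omega>)) \<partial>M \<partial>M)"
  proof (rule nn_integral_cong)
    fix \<omega>' assume \<omega>': "\<omega>' \<in> space M"
    then have "past (X \<omega>') \<in> space (\<Pi>\<^sub>M j\<in>{..k}. borel)"
      by (simp add: past space_PiM)
    then show "(\<integral>\<^sup>+f'. g (past (X \<omega>'), now f') \<partial>distr M ?J Y) = (\<integral>\<^sup>+\<omega>. g (past (X \<omega>'), now (Y \<omega>)) \<partial>M)"
      by (subst nn_integral_distr) simp_all
  qed
  also have "\<dots> = (\<integral>\<^sup>+\<omega>'. \<integral>\<^sup>+\<omega>. g (\<lambda>j\<in>{..k}. state A B x0 u j \<omega>', A k \<omega>) \<partial>M \<partial>M)"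
    by (intro nn_integral_cong) (simp add: past now)
  finally show ?thesis .
qed

lemma measurable_states:
  assumes gen: "generates \<psi> x0 u"
  shows "(\<lambda>\<omega>. \<lambda>j\<in>{..k}. state A B x0 u j \<omega>) \<in> measurable M (\<Pi>\<^sub>M j\<in>{..k}. borel)"
proof -
  have "(\<lambda>\<omega>. history \<psi> x0 k (\<lambda>j. A j \<omega>)) \<in> measurable M (\<Pi>\<^sub>M j\<in>{..k}. borel)"
    using gen by (intro measurable_history) (auto simp: generates_def)
  then show ?thesis
    by (rule measurable_cong[THEN iffD1, rotated]) (simp add: history_eq_state[OF gen])
qed

lemma measurable_state:
  assumes gen: "generates \<psi> x0 u"
  shows "state A B x0 u k \<in> borel_measurable M"
  using measurable_compose[OF measurable_states[OF gen] measurable_component_singleton[of k "{..k}"]]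
  by simp

lemma measurable_input:
  assumes gen: "generates \<psi> x0 u"
  shows "u k \<in> borel_measurable M"
proof -
  have "(\<lambda>\<omega>. local_input (\<lambda>i Z. \<psi> k i (Z, \<lambda>j\<in>{..k}. state A B x0 u j \<omega>)) (A k \<omega>)) \<in> borel_measurable M"
    using gen by (intro measurable_local_input_pair[OF _ _ measurable_states[OF gen]])
      (auto simp: generates_def)
  then show ?thesis
    by (rule measurable_cong[THEN iffD1, rotated]) (use gen in \<open>simp add: generates_def\<close>)
qed

text \<open>
  Conditionally on the states up to time \<open>k\<close>, a law acts as a local input with these states fixed.
\<close>

lemma nn_integral_one_step:
  fixes F :: "real^'n \<Rightarrow> real^'n^'n \<Rightarrow> real^'m \<Rightarrow> ennreal"
  assumes gen: "generates \<psi> x0 u"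
    and F: "(\<lambda>(x, Z, v). F x Z v) \<in> borel_measurable (borel \<Otimes>\<^sub>M borel \<Otimes>\<^sub>M borel)"
  shows "(\<integral>\<^sup>+\<omega>. F (state A B x0 u k \<omega>) (A k \<omega>) (u k \<omega>) \<partial>M)
    = (\<integral>\<^sup>+\<omega>'. \<integral>\<^sup>+\<omega>. F (state A B x0 u k \<omega>') (A k \<omega>)
        (local_input (\<lambda>i Z. \<psi> k i (Z, \<lambda>j\<in>{..k}. state A B x0 u j \<omega>')) (A k \<omega>)) \<partial>M \<partial>M)"
proof -
  define g where "g = (\<lambda>(h, Z). F (h k) Z (local_input (\<lambda>i Y. \<psi> k i (Y, h)) Z))"
  have \<psi>: "\<psi> k i \<in> borel_measurable (borel \<Otimes>\<^sub>M (\<Pi>\<^sub>M j\<in>{..k}. borel))" for i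
    using gen by (simp add: generates_def)
  have li: "(\<lambda>z. local_input (\<lambda>i Y. \<psi> k i (Y, fst z)) (snd z))
      \<in> borel_measurable ((\<Pi>\<^sub>M j\<in>{..k}. borel) \<Otimes>\<^sub>M borel)"
    by (rule measurable_local_input_pair[OF \<psi> measurable_snd measurable_fst])
  have st: "(\<lambda>z. fst z k) \<in> borel_measurable ((\<Pi>\<^sub>M j\<in>{..k}. borel :: (real^'n) measure) \<Otimes>\<^sub>M (borel :: (real^'n^'n) measure))"
    by (rule measurable_compose[OF measurable_fst measurable_component_singleton]) simp
  have g: "g \<in> borel_measurable ((\<Pi>\<^sub>M j\<in>{..k}. borel) \<Otimes>\<^sub>M borel)"
    using measurable_compose[OF measurable_Pair[OF st measurable_Pair[OF measurable_snd li]] F]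
    by (simp add: g_def case_prod_beta')
  have "(\<integral>\<^sup>+\<omega>. F (state A B x0 u k \<omega>) (A k \<omega>) (u k \<omega>) \<partial>M)
      = (\<integral>\<^sup>+\<omega>. g (\<lambda>j\<in>{..k}. state A B x0 u j \<omega>, A k \<omega>) \<partial>M)"
    using gen by (intro nn_integral_cong) (simp add: g_def generates_def)
  then show ?thesis
    unfolding nn_integral_past_present[OF gen g] by (simp add: g_def)
qed

lemma measurable_step_cost:
  "(\<lambda>(x, Z, v). ennreal (step_cost P Z x v)) \<in> borel_measurable (borel \<Otimes>\<^sub>M borel \<Otimes>\<^sub>M borel)"
  unfolding step_cost_def case_prod_beta' by measurable

text \<open>Input cost at time \<open>k\<close> and value \<open>P\<close> of the next state, for an arbitrary law and for the optimal one.\<close>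

lemma expected_step_ge:
  assumes gen: "generates \<psi> x0 u" and P: "sym_pos_semidef P"
  shows "(\<integral>\<^sup>+\<omega>. ennreal (state A B x0 u k \<omega> \<bullet> (riccati_map k P *v state A B x0 u k \<omega>)) \<partial>M)
    \<le> (\<integral>\<^sup>+\<omega>. ennreal (step_cost P (A k \<omega>) (state A B x0 u k \<omega>) (u k \<omega>)) \<partial>M)"
  unfolding nn_integral_one_step[OF gen measurable_step_cost]
proof (intro nn_integral_mono one_step_ge P)
  fix i \<omega> assume "\<omega> \<in> space M"
  then have "(\<lambda>j\<in>{..k}. state A B x0 u j \<omega>) \<in> space (\<Pi>\<^sub>M j\<in>{..k}. borel)"
    by (simp add: space_PiM)
  moreover have "\<psi> k i \<in> borel_measurable (borel \<Otimes>\<^sub>M (\<Pi>\<^sub>M j\<in>{..k}. borel))"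
    using gen by (simp add: generates_def)
  ultimately show "(\<lambda>Z. \<psi> k i (Z, \<lambda>j\<in>{..k}. state A B x0 u j \<omega>)) \<in> borel_measurable borel"
    by measurable
qed

text \<open>
  The optimal feedback as a law on block rows and state histories.
\<close>

definition optimal_law ::
    "real^'n^'n \<Rightarrow> nat \<Rightarrow> 's \<Rightarrow> (real^'n^'n) \<times> (nat \<Rightarrow> real^'n) \<Rightarrow> real^'m" where
  "optimal_law P k i = (\<lambda>(Z, h). optimal_local P (h k) i Z)"

lemma generates_optimal:
  "generates (optimal_law P) x0 (closed_loop_input A B (optimal_feedback M \<sigma> \<tau> A Abar B R P) x0)"
  unfolding generates_def
proof (intro conjI allI ballI)
  fix k :: nat and i
  have [measurable]: "(\<lambda>z. snd z k) \<in> borel_measurable ((borel :: (real^'n^'n) measure) \<Otimes>\<^sub>M (\<Pi>\<^sub>M j\<in>{..k}. borel :: (real^'n) measure))"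
    by (rule measurable_compose[OF measurable_snd measurable_component_singleton]) simp
  show "optimal_law P k i \<in> borel_measurable (borel \<Otimes>\<^sub>M (\<Pi>\<^sub>M j\<in>{..k}. borel))"
    unfolding optimal_law_def optimal_local_def case_prod_beta' matrix_vector_mul_assoc[of "block_gain P i", symmetric]
    by measurable
  fix \<omega>
  show "closed_loop_input A B (optimal_feedback M \<sigma> \<tau> A Abar B R P) x0 k \<omega>
    = local_input (\<lambda>i Z. optimal_law P k i (Z, \<lambda>j\<in>{..k}.
        state A B x0 (closed_loop_input A B (optimal_feedback M \<sigma> \<tau> A Abar B R P) x0) j \<omega>)) (A k \<omega>)"
    by (simp add: closed_loop_input_def optimal_feedback_eq optimal_law_def state_closed_loop_input)
qed

lemma expected_step_optimal:
  fixes x0 P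
  defines "u \<equiv> closed_loop_input A B (optimal_feedback M \<sigma> \<tau> A Abar B R P) x0"
  assumes P: "sym_pos_semidef P"
  shows "(\<integral>\<^sup>+\<omega>. ennreal (step_cost P (A k \<omega>) (state A B x0 u k \<omega>) (u k \<omega>)) \<partial>M)
    = (\<integral>\<^sup>+\<omega>. ennreal (state A B x0 u k \<omega> \<bullet> (riccati_map k P *v state A B x0 u k \<omega>)) \<partial>M)"
  unfolding u_def nn_integral_one_step[OF generates_optimal measurable_step_cost]
  by (simp add: optimal_law_def flip: optimal_feedback_eq) (simp add: one_step_optimal[OF P])


section \<open>Comparison of Riccati maps\<close>

lemma local_input_const: "local_input (\<lambda>i Z. v) Z = v"
  by (simp add: local_input_def vec_eq_iff)

text \<open>
  The minimizing input for \<open>Y\<close> is admissible for \<open>X\<close>. Since \<open>c \<ge> 1\<close>, scaling by \<open>c\<close> also dominates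
  the input cost.
\<close>

lemma riccati_map_compare:
  assumes X: "sym_pos_semidef X" and Y: "sym_pos_semidef Y" and c: "1 \<le> c"
    and le: "\<And>x. x \<bullet> (X *v x) \<le> c * (x \<bullet> (Y *v x))"
  shows "x \<bullet> (riccati_map k X *v x) \<le> c * (x \<bullet> (riccati_map k Y *v x))"
proof -
  let ?u = "\<lambda>\<omega>. optimal_feedback M \<sigma> \<tau> A Abar B R Y k \<omega> x"
  have pt: "step_cost X Z x v \<le> c * step_cost Y Z x v" for Z v
  proof -
    have "v \<bullet> (R *v v) \<le> c * (v \<bullet> (R *v v))"
      using mult_right_mono[OF c sym_pos_semidefD(2)[OF R_semidef, of v]] by simp
    then show ?thesis
      using le[of "Z *v x + B *v v"] by (simp add: step_cost_def distrib_left)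
  qed
  have "ennreal (x \<bullet> (riccati_map k X *v x))
      \<le> (\<integral>\<^sup>+\<omega>. ennreal (step_cost X (A k \<omega>) x (?u \<omega>)) \<partial>M)"
    unfolding optimal_feedback_eq by (intro one_step_ge X borel_measurable_optimal_local)
  also have "\<dots> = ennreal (\<integral>\<omega>. step_cost X (A k \<omega>) x (?u \<omega>) \<partial>M)"
    by (intro nn_integral_eq_integral integrable_step_cost sq_integrable_optimal_feedback AE_I2
        step_cost_nonneg X)
  finally have "x \<bullet> (riccati_map k X *v x) \<le> (\<integral>\<omega>. step_cost X (A k \<omega>) x (?u \<omega>) \<partial>M)"
    by (subst (asm) ennreal_le_iff)
      (auto intro!: Bochner_Integration.integral_nonneg step_cost_nonneg X)
  also have "\<dots> \<le> (\<integral>\<omega>. c * step_cost Y (A k \<omega>) x (?u \<omega>) \<partial>M)"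
    by (intro integral_mono integrable_step_cost sq_integrable_optimal_feedback integrable_mult_right pt)
  also have "\<dots> = c * (x \<bullet> (riccati_map k Y *v x))"
    by (simp add: integral_step_cost_optimal[OF Y])
  finally show ?thesis .
qed

section \<open>Linear feedback\<close>

text \<open>
  The quadratic form of \<open>feedback_map L X\<close> at \<open>x\<close> is the expectation of the form of \<open>X\<close> at the
  successor of \<open>x\<close> under the linear feedback with gain \<open>L\<close>. The matrix is defined by the moments at
  time 0; by \<open>quadratic_feedback_map\<close> every other time gives the same form.
\<close>

definition feedback_map :: "real^'n^'m \<Rightarrow> real^'n^'n \<Rightarrow> real^'n^'n" where
  "feedback_map L X = (\<integral>\<omega>. transpose (A 0 \<omega> + B ** L) ** X ** (A 0 \<omega> + B ** L) \<partial>M)"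

lemma sq_integrable_closed_loop: "sq_integrable M (\<lambda>\<omega>. A k \<omega> + B ** L)"
  by (intro sq_integrable_add sq_integrable_A sq_integrable_const)

lemma integrable_feedback:
  "integrable M (\<lambda>\<omega>. transpose (A k \<omega> + B ** L) ** X ** (A k \<omega> + B ** L))"
  by (rule integrable_matrix_congruence[OF sq_integrable_closed_loop])

lemma quadratic_feedback_map_0:
  "x \<bullet> (feedback_map L X *v x) = (\<integral>\<omega>. ((A 0 \<omega> + B ** L) *v x) \<bullet> (X *v ((A 0 \<omega> + B ** L) *v x)) \<partial>M)"
  unfolding feedback_map_def
  using integral_bounded_linear[OF bounded_linear_quadratic_form integrable_feedback[of 0 L X], of x]
  by (simp add: quadratic_form_congruence)

lemma quadratic_feedback_map:
  assumes X: "transpose X = X"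
  shows "(\<integral>\<omega>. ((A k \<omega> + B ** L) *v x) \<bullet> (X *v ((A k \<omega> + B ** L) *v x)) \<partial>M) = x \<bullet> (feedback_map L X *v x)"
proof -
  have "(\<integral>\<omega>. ((A k \<omega> + B ** L) *v x) \<bullet> (X *v ((A k \<omega> + B ** L) *v x)) \<partial>M)
      = ((Abar + B ** L) *v x) \<bullet> (X *v ((Abar + B ** L) *v x))
        + (\<integral>\<omega>. ((A k \<omega> - Abar) *v x) \<bullet> (X *v ((A k \<omega> - Abar) *v x)) \<partial>M)" for k
  proof -
    have sq: "sq_integrable M (\<lambda>\<omega>. (A k \<omega> - Abar) *v x)"
      by (intro sq_integrable_matrix_vector_const sq_integrable_diff sq_integrable_A sq_integrable_const)
    have 0: "(\<integral>\<omega>. (A k \<omega> - Abar) *v x \<partial>M) = 0"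
      using sq_integrable_imp_integrable[OF sq_integrable_matrix_vector_const[OF sq_integrable_A]]
      by (simp add: matrix_vector_mult_diff_rdistrib integral_A_vector prob_space)
    have "(A k \<omega> + B ** L) *v x = (Abar + B ** L) *v x + (A k \<omega> - Abar) *v x" for \<omega>
      by (simp add: matrix_vector_mult_add_rdistrib matrix_vector_mult_diff_rdistrib)
    then show ?thesis
      using integral_quadratic_sum_orthogonal[OF X, of "\<lambda>_::unit. \<lambda>\<omega>. (A k \<omega> - Abar) *v x"
          "(Abar + B ** L) *v x"]
        sq 0 by simp
  qed
  then show ?thesis
    unfolding quadratic_feedback_map_0 using centered_form_time_invariant[of k x X x 0] by simp
qed

lemma integrable_feedback_form:
  "integrable M (\<lambda>\<omega>. ((A k \<omega> + B ** L) *v x) \<bullet> (X *v ((A k \<omega> + B ** L) *v x)))"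
  by (intro sq_integrable_quadratic sq_integrable_matrix_vector_const sq_integrable_closed_loop)

lemma feedback_map_semidef:
  assumes "sym_pos_semidef X"
  shows "sym_pos_semidef (feedback_map L X)"
  unfolding sym_pos_semidef_def
proof (intro conjI allI)
  have bl: "bounded_linear (transpose :: real^'n^'n \<Rightarrow> real^'n^'n)"
    by (auto simp: linear_conv_bounded_linear[symmetric] linear_iff transpose_def vec_eq_iff)
  show "transpose (feedback_map L X) = feedback_map L X"
    unfolding feedback_map_def
    using integral_bounded_linear[OF bl integrable_feedback[of 0 L X]]
    by (simp add: transpose_congruence sym_pos_semidefD(1)[OF assms])
  show "0 \<le> x \<bullet> (feedback_map L X *v x)" for x
    unfolding quadratic_feedback_map_0
    by (intro Bochner_Integration.integral_nonneg sym_pos_semidefD(2) assms)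
qed

lemma feedback_map_compare:
  assumes "\<And>x. x \<bullet> (X *v x) \<le> c * (x \<bullet> (Y *v x))"
  shows "x \<bullet> (feedback_map L X *v x) \<le> c * (x \<bullet> (feedback_map L Y *v x))"
proof -
  have "x \<bullet> (feedback_map L X *v x)
      \<le> (\<integral>\<omega>. c * (((A 0 \<omega> + B ** L) *v x) \<bullet> (Y *v ((A 0 \<omega> + B ** L) *v x))) \<partial>M)"
    unfolding quadratic_feedback_map_0
    by (intro integral_mono integrable_feedback_form integrable_mult_right assms)
  then show ?thesis by (simp add: quadratic_feedback_map_0)
qed

lemma feedback_map_sum: "feedback_map L (\<Sum>i\<in>I. X i) = (\<Sum>i\<in>I. feedback_map L (X i))"
proof -
  have add: "feedback_map L (X + Y) = feedback_map L X + feedback_map L Y" for X Y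
  proof -
    have "transpose D ** (X + Y) ** D = transpose D ** X ** D + transpose D ** Y ** D"
      for D :: "real^'n^'n"
      by (simp only: matrix_add_ldistrib matrix_add_rdistrib)
    then show ?thesis
      unfolding feedback_map_def by (simp add: integrable_feedback)
  qed
  have zero: "feedback_map L 0 = 0"
    using add[of 0 0] by simp
  show ?thesis
    by (induction I rule: infinite_finite_induct) (simp_all add: add zero)
qed

text \<open>
  Linear feedback is a law with limited model information, so it cannot beat the minimum.
\<close>

lemma riccati_map_le_feedback:
  assumes X: "sym_pos_semidef X"
  shows "x \<bullet> (riccati_map k X *v x) \<le> (L *v x) \<bullet> (R *v (L *v x)) + x \<bullet> (feedback_map L X *v x)"
proof -
  have step: "step_cost X (A k \<omega>) x (L *v x) = (L *v x) \<bullet> (R *v (L *v x))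
      + ((A k \<omega> + B ** L) *v x) \<bullet> (X *v ((A k \<omega> + B ** L) *v x))" for \<omega>
    by (simp add: step_cost_def matrix_vector_mult_add_rdistrib matrix_vector_mul_assoc)
  have "ennreal (x \<bullet> (riccati_map k X *v x)) \<le> (\<integral>\<^sup>+\<omega>. ennreal (step_cost X (A k \<omega>) x (L *v x)) \<partial>M)"
    using one_step_ge[OF X, of "\<lambda>i Z. L *v x" x k] by (simp add: local_input_const)
  also have "\<dots> = ennreal (\<integral>\<omega>. step_cost X (A k \<omega>) x (L *v x) \<partial>M)"
    by (intro nn_integral_eq_integral integrable_step_cost sq_integrable_const AE_I2
        step_cost_nonneg X)
  finally have "x \<bullet> (riccati_map k X *v x) \<le> (\<integral>\<omega>. step_cost X (A k \<omega>) x (L *v x) \<partial>M)"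
    by (subst (asm) ennreal_le_iff)
      (auto intro!: Bochner_Integration.integral_nonneg step_cost_nonneg X)
  also have "\<dots> = (L *v x) \<bullet> (R *v (L *v x)) + x \<bullet> (feedback_map L X *v x)"
    unfolding step using quadratic_feedback_map[OF sym_pos_semidefD(1)[OF X], of k L x]
    by (simp add: integrable_feedback_form prob_space)
  finally show ?thesis .
qed

lemma generates_feedback:
  "generates (\<lambda>k i (Z, h). L *v h k) x0 (closed_loop_input A B (\<lambda>k \<omega> x. L *v x) x0)"
  unfolding generates_def
proof (intro conjI allI ballI)
  fix k :: nat and i :: 's
  have [measurable]: "(\<lambda>z. snd z k) \<in> borel_measurable ((borel :: (real^'n^'n) measure) \<Otimes>\<^sub>M (\<Pi>\<^sub>M j\<in>{..k}. borel :: (real^'n) measure))"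
    by (rule measurable_compose[OF measurable_snd measurable_component_singleton]) simp
  show "(\<lambda>(Z, h). L *v h k) \<in> borel_measurable ((borel :: (real^'n^'n) measure) \<Otimes>\<^sub>M (\<Pi>\<^sub>M j\<in>{..k}. borel))"
    unfolding case_prod_beta' by measurable
qed (simp add: closed_loop_input_def state_closed_loop_input local_input_const)

text \<open>
  Expected quadratic forms along the linear feedback evolve by iterating the feedback map.
\<close>

lemma second_moment_closed_loop:
  fixes x0 L
  defines "x \<equiv> closed_loop_state A B (\<lambda>k \<omega> x. L *v x) x0"
  assumes X: "sym_pos_semidef X"
  shows "(\<integral>\<^sup>+\<omega>. ennreal (x k \<omega> \<bullet> (X *v x k \<omega>)) \<partial>M) = ennreal (x0 \<bullet> ((feedback_map L ^^ k) X *v x0))"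
  using X
proof (induction k arbitrary: X)
  case 0
  then show ?case by (simp add: x_def emeasure_space_1)
next
  case (Suc k)
  let ?u = "closed_loop_input A B (\<lambda>k \<omega> x. L *v x) x0"
  define F where "F x Z v = ennreal ((Z *v x + B *v v) \<bullet> (X *v (Z *v x + B *v v)))"
    for x :: "real^'n" and Z :: "real^'n^'n" and v :: "real^'m"
  have F: "(\<lambda>(x, Z, v). F x Z v) \<in> borel_measurable (borel \<Otimes>\<^sub>M borel \<Otimes>\<^sub>M borel)"
    unfolding F_def case_prod_beta' by measurable
  have "(\<integral>\<^sup>+\<omega>. ennreal (x (Suc k) \<omega> \<bullet> (X *v x (Suc k) \<omega>)) \<partial>M)
      = (\<integral>\<^sup>+\<omega>. F (state A B x0 ?u k \<omega>) (A k \<omega>) (?u k \<omega>) \<partial>M)"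
    by (simp add: x_def F_def closed_loop_input_def state_closed_loop_input)
  also have "\<dots> = (\<integral>\<^sup>+\<omega>'. \<integral>\<^sup>+\<omega>. ennreal (((A k \<omega> + B ** L) *v x k \<omega>') \<bullet> (X *v ((A k \<omega> + B ** L) *v x k \<omega>'))) \<partial>M \<partial>M)"
    unfolding nn_integral_one_step[OF generates_feedback F]
    by (simp add: local_input_const F_def x_def state_closed_loop_input
        matrix_vector_mult_add_rdistrib matrix_vector_mul_assoc)
  also have "\<dots> = (\<integral>\<^sup>+\<omega>'. ennreal (x k \<omega>' \<bullet> (feedback_map L X *v x k \<omega>')) \<partial>M)"
    by (subst nn_integral_eq_integral)
      (auto simp: integrable_feedback_form sym_pos_semidefD[OF Suc.prems] quadratic_feedback_map)
  also have "\<dots> = ennreal (x0 \<bullet> ((feedback_map L ^^ Suc k) X *v x0))"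
    using Suc.IH[OF feedback_map_semidef[OF Suc.prems]] by (simp add: funpow_swap1)
  finally show ?case .
qed

lemma feedback_map_power_semidef: "sym_pos_semidef X \<Longrightarrow> sym_pos_semidef ((feedback_map L ^^ k) X)"
  by (induction k) (simp_all add: feedback_map_semidef)

lemma sym_pos_semidef_mat1: "sym_pos_semidef (mat 1 :: real^'n^'n)"
  by (simp add: sym_pos_semidef_def)

text \<open>
  Under a mean square stabilizing gain the matrices \<open>T\<^sup>k I\<close>, with \<open>T\<close> the feedback map, tend
  to zero. Hence some power of \<open>T\<close> contracts, and the series of these matrices is bounded.
\<close>

lemma stabilizing_feedback_bound:
  assumes stab: "mean_square_stable M A B (\<lambda>k \<omega> x. L *v x)"
  obtains C where "\<And>T x. (\<Sum>k<T. x \<bullet> ((feedback_map L ^^ k) (mat 1) *v x)) \<le> C x"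
proof -
  define N where "N k = (feedback_map L ^^ k) (mat 1)" for k
  have N: "sym_pos_semidef (N k)" for k
    unfolding N_def by (rule feedback_map_power_semidef[OF sym_pos_semidef_mat1])
  have form: "(\<lambda>k. x \<bullet> (N k *v x)) \<longlonglongrightarrow> 0" for x
  proof -
    let ?x = "closed_loop_state A B (\<lambda>k \<omega> x. L *v x) x"
    have "(\<lambda>k. \<integral>\<^sup>+\<omega>. ennreal (?x k \<omega> \<bullet> ?x k \<omega>) \<partial>M) \<longlonglongrightarrow> 0"
      using stab unfolding mean_square_stable_def by blast
    moreover have "(\<integral>\<^sup>+\<omega>. ennreal (?x k \<omega> \<bullet> ?x k \<omega>) \<partial>M) = ennreal (x \<bullet> (N k *v x))" for k
      using second_moment_closed_loop[OF sym_pos_semidef_mat1, where ?x0.0 = x and L = L and k = k] by (simp add: N_def)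
    ultimately have "(\<lambda>k. ennreal (x \<bullet> (N k *v x))) \<longlonglongrightarrow> ennreal 0" by simp
    then show ?thesis
      by (subst (asm) tendsto_ennreal_iff) (auto simp: sym_pos_semidefD[OF N])
  qed
  have "(\<lambda>k. N k $ i $ j) \<longlonglongrightarrow> 0" for i j
    unfolding matrix_entry_polarization[OF sym_pos_semidefD(1)[OF N]]
    using tendsto_divide[OF tendsto_diff[OF tendsto_diff[OF form form] form] tendsto_const[of 2]]
    by simp
  then have "N \<longlonglongrightarrow> 0"
    by (intro vec_tendstoI) simp
  then have "\<forall>\<^sub>F k in sequentially. norm (N k) < 1 / 2"
    using tendstoD[of N 0 sequentially "1 / 2"] by simp
  then obtain K where K: "norm (N K) < 1 / 2"
    by (auto simp: eventually_sequentially)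
  have contract: "x \<bullet> (N (K + k) *v x) \<le> (1 / 2) * (x \<bullet> (N k *v x))" for k x
  proof (induction k arbitrary: x)
    case 0
    have "x \<bullet> (N K *v x) \<le> norm (N K) * (x \<bullet> x)"
      using quadratic_form_le_norm[of x "N K"] by simp
    also have "\<dots> \<le> (1 / 2) * (x \<bullet> x)"
      using K by (intro mult_right_mono) auto
    finally show ?case by (simp add: N_def)
  next
    case (Suc k)
    from feedback_map_compare[OF Suc] show ?case by (simp add: N_def)
  qed
  have "(\<Sum>k<T. x \<bullet> (N k *v x)) \<le> 2 * (\<Sum>k<K. x \<bullet> (N k *v x))" for T x
  proof -
    let ?f = "\<lambda>k. x \<bullet> (N k *v x)"
    have "(\<Sum>k<T. ?f k) \<le> (\<Sum>k<K + T. ?f k)"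
      by (intro sum_mono2) (auto simp: sym_pos_semidefD[OF N])
    also have "\<dots> = (\<Sum>k<K. ?f k) + (\<Sum>k<T. ?f (K + k))"
      by (induction T) auto
    also have "(\<Sum>k<T. ?f (K + k)) \<le> (\<Sum>k<T. (1 / 2) * ?f k)"
      by (intro sum_mono contract)
    also have "\<dots> = (1 / 2) * (\<Sum>k<T. ?f k)"
      by (rule sum_distrib_left[symmetric])
    finally show ?thesis by simp
  qed
  then show thesis
    using that[of "\<lambda>x. 2 * (\<Sum>k<K. x \<bullet> (N k *v x))"] by (simp add: N_def)
qed

section \<open>Value iteration\<close>

text \<open>
  The matrix of the optimal cost over \<open>T\<close> steps with no terminal cost.
\<close>

primrec value_iterate :: "real^'n^'n \<Rightarrow> nat \<Rightarrow> real^'n^'n" where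
  "value_iterate Q 0 = 0"
| "value_iterate Q (Suc T) = Q + riccati_map 0 (value_iterate Q T)"

lemma quadratic_value_iterate_Suc:
  "x \<bullet> (value_iterate Q (Suc T) *v x) = x \<bullet> (Q *v x) + x \<bullet> (riccati_map 0 (value_iterate Q T) *v x)"
  by (simp add: matrix_vector_mult_add_rdistrib inner_add_right)

lemma value_iterate_semidef:
  assumes "sym_pos_semidef Q"
  shows "sym_pos_semidef (value_iterate Q T)"
proof (induction T)
  case 0
  show ?case by (simp add: sym_pos_semidef_def transpose_def vec_eq_iff)
next
  case (Suc T)
  then show ?case by (simp add: sym_pos_semidef_add assms riccati_map_semidef)
qed

lemma value_iterate_incseq:
  assumes Q: "sym_pos_semidef Q"
  shows "incseq (\<lambda>T. x \<bullet> (value_iterate Q T *v x))"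
proof (rule incseq_SucI)
  show "x \<bullet> (value_iterate Q T *v x) \<le> x \<bullet> (value_iterate Q (Suc T) *v x)" for T
  proof (induction T arbitrary: x)
    case 0
    show ?case
      using sym_pos_semidefD(2)[OF value_iterate_semidef[OF Q], of x "Suc 0"]
      by (simp del: value_iterate.simps(2))
  next
    case (Suc T)
    have "x \<bullet> (riccati_map 0 (value_iterate Q T) *v x)
        \<le> 1 * (x \<bullet> (riccati_map 0 (value_iterate Q (Suc T)) *v x))"
      using Suc by (intro riccati_map_compare value_iterate_semidef Q) simp_all
    then show ?case unfolding quadratic_value_iterate_Suc by simp
  qed
qed

lemma value_iterate_bounded:
  assumes Q: "sym_pos_semidef Q" and stab: "mean_square_stabilizable M A B"
  obtains C where "\<And>T x. x \<bullet> (value_iterate Q T *v x) \<le> C x"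
proof -
  obtain L where L: "mean_square_stable M A B (\<lambda>k \<omega> x. L *v x)"
    using stab by (auto simp: mean_square_stabilizable_def)
  define N where "N k = (feedback_map L ^^ k) (mat 1)" for k
  define c where "c = norm (Q + transpose L ** R ** L)"
  have stage: "x \<bullet> (Q *v x) + (L *v x) \<bullet> (R *v (L *v x)) \<le> c * (x \<bullet> x)" for x
    using quadratic_form_le_norm[of x "Q + transpose L ** R ** L"]
    by (simp add: c_def matrix_vector_mult_add_rdistrib inner_add_right quadratic_form_congruence)
  have bound: "x \<bullet> (value_iterate Q T *v x) \<le> c * (x \<bullet> ((\<Sum>k<T. N k) *v x))" for T x
  proof (induction T arbitrary: x)
    case (Suc T)
    have "(\<Sum>k<Suc T. N k) = mat 1 + feedback_map L (\<Sum>k<T. N k)"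
      unfolding feedback_map_sum sum.lessThan_Suc_shift by (simp add: N_def)
    then have "c * (x \<bullet> ((\<Sum>k<Suc T. N k) *v x))
        = c * (x \<bullet> x) + c * (x \<bullet> (feedback_map L (\<Sum>k<T. N k) *v x))"
      by (simp add: matrix_vector_mult_add_rdistrib inner_add_right distrib_left)
    moreover have "x \<bullet> (feedback_map L (value_iterate Q T) *v x)
        \<le> c * (x \<bullet> (feedback_map L (\<Sum>k<T. N k) *v x))"
      by (rule feedback_map_compare[OF Suc])
    ultimately show ?case
      unfolding quadratic_value_iterate_Suc
      using riccati_map_le_feedback[OF value_iterate_semidef[OF Q], of x 0 T L] stage[of x] by simp
  qed simp
  obtain D where D: "\<And>T x. (\<Sum>k<T. x \<bullet> (N k *v x)) \<le> D x"
    unfolding N_def by (rule stabilizing_feedback_bound[OF L]) blast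
  have "x \<bullet> (value_iterate Q T *v x) \<le> c * D x" for T x
  proof -
    have "c * (x \<bullet> ((\<Sum>k<T. N k) *v x)) \<le> c * D x"
      using D[of x T] by (intro mult_left_mono) (simp_all add: c_def matrix_vector_sum_left inner_sum_right)
    then show ?thesis using bound[of x T] by simp
  qed
  then show thesis by (rule that)
qed

lemma value_iterate_converges:
  assumes Q: "sym_pos_semidef Q" and stab: "mean_square_stabilizable M A B"
  obtains P where "value_iterate Q \<longlonglongrightarrow> P"
proof -
  let ?V = "value_iterate Q"
  obtain C where C: "\<And>T x. x \<bullet> (?V T *v x) \<le> C x"
    by (rule value_iterate_bounded[OF assms]) blast
  have "convergent (\<lambda>T. x \<bullet> (?V T *v x))" for x
  proof (rule Bseq_mono_convergent)
    show "Bseq (\<lambda>T. x \<bullet> (?V T *v x))"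
      using C[of x] sym_pos_semidefD(2)[OF value_iterate_semidef[OF Q]]
      by (intro BseqI'[of _ "C x"]) simp
    show "\<forall>m n. m \<le> n \<longrightarrow> x \<bullet> (?V m *v x) \<le> x \<bullet> (?V n *v x)"
      using value_iterate_incseq[OF Q] by (simp add: incseq_def)
  qed
  then obtain f where f: "\<And>x. (\<lambda>T. x \<bullet> (?V T *v x)) \<longlonglongrightarrow> f x"
    unfolding convergent_def by metis
  have "(\<lambda>T. ?V T $ i $ j) \<longlonglongrightarrow> (f (axis i 1 + axis j 1) - f (axis i 1) - f (axis j 1)) / 2" for i j
    unfolding matrix_entry_polarization[OF sym_pos_semidefD(1)[OF value_iterate_semidef[OF Q]]]
    by (intro tendsto_intros f) simp
  then have "?V \<longlonglongrightarrow> (\<chi> i j. (f (axis i 1 + axis j 1) - f (axis i 1) - f (axis j 1)) / 2)"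
    by (intro vec_tendstoI) simp
  then show thesis by (rule that)
qed

text \<open>
  The limit is a fixed point. Continuity of the Riccati map is not needed: near the limit \<open>P\<close> the
  iterates satisfy \<open>P \<le> (1 + e) P\<^sub>T\<close>, and the Riccati map respects such comparisons.
\<close>

lemma riccati_fixed_point_exists:
  assumes Q: "sym_pos_def Q" and stab: "mean_square_stabilizable M A B"
  obtains P where "sym_pos_def P" "P = Q + riccati_map 0 P"
proof -
  note Qs = sym_pos_def_imp_semidef[OF Q]
  let ?V = "value_iterate Q"
  note V = value_iterate_semidef[OF Qs]
  obtain P where lim: "?V \<longlonglongrightarrow> P"
    using value_iterate_converges[OF Qs stab] by blast
  have form: "(\<lambda>T. x \<bullet> (?V T *v x)) \<longlonglongrightarrow> x \<bullet> (P *v x)" for x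
    by (rule bounded_linear.tendsto[OF bounded_linear_quadratic_form lim])
  have le: "x \<bullet> (?V T *v x) \<le> x \<bullet> (P *v x)" for x T
    by (rule incseq_le[OF value_iterate_incseq[OF Qs] form])
  have tP: "transpose P = P"
  proof -
    have "bounded_linear (transpose :: real^'n^'n \<Rightarrow> real^'n^'n)"
      by (auto simp: linear_conv_bounded_linear[symmetric] linear_iff transpose_def vec_eq_iff)
    from bounded_linear.tendsto[OF this lim] have "?V \<longlonglongrightarrow> transpose P"
      by (simp add: sym_pos_semidefD(1)[OF V])
    then show ?thesis using lim LIMSEQ_unique by blast
  qed
  have Q_le: "x \<bullet> (Q *v x) \<le> x \<bullet> (?V (Suc T) *v x)" for x T
    unfolding quadratic_value_iterate_Suc
    using sym_pos_semidefD(2)[OF riccati_map_semidef[OF V]] by simp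
  have P_pos: "sym_pos_def P"
    unfolding sym_pos_def_def
  proof (intro conjI allI impI tP)
    fix x :: "real^'n" assume "x \<noteq> 0"
    then have "0 < x \<bullet> (Q *v x)" using Q by (simp add: sym_pos_def_def)
    with Q_le[of x 0] le[of x "Suc 0"] show "0 < x \<bullet> (P *v x)" by simp
  qed
  note P = sym_pos_def_imp_semidef[OF P_pos]
  obtain c where c: "0 < c" "\<And>x. c * (x \<bullet> x) \<le> x \<bullet> (Q *v x)"
    using sym_pos_def_lower_bound[OF Q] by blast
  have below: "x \<bullet> (P *v x) \<le> x \<bullet> (Q *v x) + x \<bullet> (riccati_map 0 P *v x)" for x
  proof (rule LIMSEQ_le_const2[OF form], intro exI[of _ 1] allI impI)
    fix T :: nat assume "1 \<le> T"
    then obtain T' where T: "T = Suc T'" by (cases T) auto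
    have "x \<bullet> (riccati_map 0 (?V T') *v x) \<le> 1 * (x \<bullet> (riccati_map 0 P *v x))"
      using le by (intro riccati_map_compare V P) simp_all
    then show "x \<bullet> (?V T *v x) \<le> x \<bullet> (Q *v x) + x \<bullet> (riccati_map 0 P *v x)"
      unfolding T quadratic_value_iterate_Suc by simp
  qed
  have above: "x \<bullet> (Q *v x) + x \<bullet> (riccati_map 0 P *v x) \<le> (1 + e) * (x \<bullet> (P *v x))" if "0 < e" for e x
  proof -
    have "\<forall>\<^sub>F T in sequentially. dist (?V T) P < e * c"
      using c(1) that by (intro tendstoD[OF lim]) simp
    then obtain T0 where "\<And>T. T \<ge> T0 \<Longrightarrow> dist (?V T) P < e * c"
      by (auto simp: eventually_sequentially)
    then have close: "norm (P - ?V (Suc T0)) \<le> e * c"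
      by (metis dist_commute dist_norm le_Suc_eq less_eq_real_def order_refl)
    let ?T = "Suc T0"
    have "x \<bullet> (P *v x) \<le> (1 + e) * (x \<bullet> (?V ?T *v x))" for x
    proof -
      have "x \<bullet> ((P - ?V ?T) *v x) \<le> norm (P - ?V ?T) * (x \<bullet> x)"
        using quadratic_form_le_norm[of x "P - ?V ?T"] by simp
      also have "\<dots> \<le> e * (c * (x \<bullet> x))"
        using mult_right_mono[OF close, of "x \<bullet> x"] by (simp add: mult.assoc)
      also have "\<dots> \<le> e * (x \<bullet> (?V ?T *v x))"
        using that order_trans[OF c(2) Q_le] by (intro mult_left_mono) auto
      finally show ?thesis
        by (simp only: matrix_vector_mult_diff_rdistrib inner_diff_right) (simp add: algebra_simps)
    qed
    then have "x \<bullet> (riccati_map 0 P *v x) \<le> (1 + e) * (x \<bullet> (riccati_map 0 (?V ?T) *v x))"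
      using that by (intro riccati_map_compare P V) simp_all
    moreover have "x \<bullet> (Q *v x) \<le> (1 + e) * (x \<bullet> (Q *v x))"
      using that mult_right_mono[of 1 "1 + e" "x \<bullet> (Q *v x)"] sym_pos_semidefD(2)[OF Qs, of x] by simp
    ultimately have "x \<bullet> (Q *v x) + x \<bullet> (riccati_map 0 P *v x) \<le> (1 + e) * (x \<bullet> (?V (Suc ?T) *v x))"
      unfolding quadratic_value_iterate_Suc[of _ _ "Suc T0"] distrib_left by (rule add_mono[rotated])
    also have "\<dots> \<le> (1 + e) * (x \<bullet> (P *v x))"
      using that by (intro mult_left_mono le) simp
    finally show ?thesis .
  qed
  have "P = Q + riccati_map 0 P"
  proof (rule symmetric_matrix_eqI[OF tP])
    show "transpose (Q + riccati_map 0 P) = Q + riccati_map 0 P"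
      by (intro sym_pos_semidefD(1) sym_pos_semidef_add Qs riccati_map_semidef P)
    fix x
    have "x \<bullet> (Q *v x) + x \<bullet> (riccati_map 0 P *v x) \<le> x \<bullet> (P *v x)"
    proof (rule field_le_epsilon)
      \<comment> \<open>choose \<open>e\<close> in the preceding bound with \<open>e * ?p \<le> d\<close>; the \<open>1\<close> covers \<open>?p = 0\<close>\<close>
      fix d :: real assume d: "0 < d"
      let ?p = "x \<bullet> (P *v x)"
      have p: "0 \<le> ?p" by (rule sym_pos_semidefD(2)[OF P])
      have "d / (?p + 1) * ?p \<le> d"
        using d p by (simp add: field_simps)
      then have "(1 + d / (?p + 1)) * ?p \<le> ?p + d"
        by (simp add: distrib_right)
      with above[of "d / (?p + 1)" x] d p
      show "x \<bullet> (Q *v x) + x \<bullet> (riccati_map 0 P *v x) \<le> ?p + d" by simp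
    qed
    with below[of x] show "x \<bullet> (P *v x) = x \<bullet> ((Q + riccati_map 0 P) *v x)"
      by (simp add: matrix_vector_mult_add_rdistrib inner_add_right)
  qed
  with P_pos show thesis by (rule that)
qed

section \<open>Verification\<close>

text \<open>
  The expected cost incurred at time \<open>k\<close>, and the expected form \<open>E[x(k) \<bullet> X x(k)]\<close>, both valued
  in \<open>[0, \<infinity>]\<close>. Negative values of the form count as 0; for semidefinite \<open>X\<close> there are none.
\<close>

definition stage_cost :: "real^'n^'n \<Rightarrow> real^'n \<Rightarrow> (nat \<Rightarrow> 'w \<Rightarrow> real^'m) \<Rightarrow> nat \<Rightarrow> ennreal" where
  "stage_cost Q x0 u k = (\<integral>\<^sup>+\<omega>. ennreal (state A B x0 u k \<omega> \<bullet> (Q *v state A B x0 u k \<omega>)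
      + u k \<omega> \<bullet> (R *v u k \<omega>)) \<partial>M)"

definition expected_form :: "real^'n^'n \<Rightarrow> real^'n \<Rightarrow> (nat \<Rightarrow> 'w \<Rightarrow> real^'m) \<Rightarrow> nat \<Rightarrow> ennreal" where
  "expected_form X x0 u k = (\<integral>\<^sup>+\<omega>. ennreal (state A B x0 u k \<omega> \<bullet> (X *v state A B x0 u k \<omega>)) \<partial>M)"

lemma expected_form_0: "expected_form X x0 u 0 = ennreal (x0 \<bullet> (X *v x0))"
  by (simp add: expected_form_def emeasure_space_1)

lemma cost_eq_suminf:
  assumes gen: "generates \<psi> x0 u" and Q: "sym_pos_semidef Q"
  shows "cost M A B Q R x0 u = (\<Sum>k. stage_cost Q x0 u k)"
proof -
  note [measurable] = measurable_state[OF gen] measurable_input[OF gen]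
  have nonneg: "0 \<le> state A B x0 u k \<omega> \<bullet> (Q *v state A B x0 u k \<omega>) + u k \<omega> \<bullet> (R *v u k \<omega>)" for k \<omega>
    by (intro add_nonneg_nonneg sym_pos_semidefD(2) Q R_semidef)
  have "(\<integral>\<^sup>+\<omega>. ennreal (\<Sum>k<T. state A B x0 u k \<omega> \<bullet> (Q *v state A B x0 u k \<omega>)
      + u k \<omega> \<bullet> (R *v u k \<omega>)) \<partial>M) = (\<Sum>k<T. stage_cost Q x0 u k)" for T
    unfolding stage_cost_def
    by (subst nn_integral_sum[symmetric]) (simp_all add: sum_ennreal nonneg)
  moreover have "(\<lambda>T. \<Sum>k<T. stage_cost Q x0 u k) \<longlonglongrightarrow> (\<Sum>k. stage_cost Q x0 u k)"
    by (intro summable_LIMSEQ) simp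
  ultimately show ?thesis
    unfolding cost_def by (simp add: limI)
qed

lemma stage_cost_split:
  assumes gen: "generates \<psi> x0 u" and Q: "sym_pos_semidef Q" and P: "sym_pos_semidef P"
  shows "stage_cost Q x0 u k + expected_form P x0 u (Suc k)
    = expected_form Q x0 u k + (\<integral>\<^sup>+\<omega>. ennreal (step_cost P (A k \<omega>) (state A B x0 u k \<omega>) (u k \<omega>)) \<partial>M)"
proof -
  note [measurable] = measurable_state[OF gen] measurable_input[OF gen]
  show ?thesis
    unfolding stage_cost_def expected_form_def step_cost_def state.simps
    by (subst (1 2) nn_integral_add[symmetric])
      (auto simp: sym_pos_semidefD(2)[OF Q] sym_pos_semidefD(2)[OF P] sym_pos_semidefD(2)[OF R_semidef]
        add.assoc ennreal_plus[symmetric] simp del: ennreal_plus)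
qed

lemma expected_form_fixed_point:
  assumes gen: "generates \<psi> x0 u" and Q: "sym_pos_semidef Q" and P: "sym_pos_semidef P"
    and fix_P: "P = Q + riccati_map 0 P"
  shows "expected_form P x0 u k = expected_form Q x0 u k
    + (\<integral>\<^sup>+\<omega>. ennreal (state A B x0 u k \<omega> \<bullet> (riccati_map k P *v state A B x0 u k \<omega>)) \<partial>M)"
proof -
  note [measurable] = measurable_state[OF gen]
  have "x \<bullet> (P *v x) = x \<bullet> (Q *v x) + x \<bullet> (riccati_map k P *v x)" for x
    by (subst fix_P) (simp add: matrix_vector_mult_add_rdistrib inner_add_right
        riccati_map_time_invariant[of k P 0])
  then show ?thesis
    unfolding expected_form_def
    by (subst nn_integral_add[symmetric])
      (auto simp: sym_pos_semidefD(2)[OF Q] sym_pos_semidefD(2)[OF riccati_map_semidef[OF P]])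
qed

text \<open>
  Finite cost forces the second moments of the state to 0, since \<open>Q\<close> dominates a multiple of the
  identity. No sign condition on \<open>X\<close> is needed.
\<close>

lemma expected_form_tendsto_0:
  assumes gen: "generates \<psi> x0 u" and Q: "sym_pos_def Q"
    and fin: "(\<Sum>k. stage_cost Q x0 u k) \<noteq> \<infinity>"
  shows "expected_form X x0 u \<longlonglongrightarrow> 0"
proof -
  note [measurable] = measurable_state[OF gen] measurable_input[OF gen]
  obtain c where c: "0 < c" "\<And>x. c * (x \<bullet> x) \<le> x \<bullet> (Q *v x)"
    using sym_pos_def_lower_bound[OF Q] by blast
  have le: "expected_form X x0 u k \<le> ennreal (norm X / c) * stage_cost Q x0 u k" for k
  proof -
    have "x \<bullet> (X *v x) \<le> norm X / c * (x \<bullet> (Q *v x) + v \<bullet> (R *v v))" for x v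
    proof -
      have "x \<bullet> (X *v x) \<le> norm X / c * (c * (x \<bullet> x))"
        using quadratic_form_le_norm[of x X] c(1) by simp
      also have "\<dots> \<le> norm X / c * (x \<bullet> (Q *v x) + v \<bullet> (R *v v))"
        using c sym_pos_semidefD(2)[OF R_semidef, of v] by (intro mult_left_mono add_increasing2) auto
      finally show ?thesis .
    qed
    then show ?thesis
      unfolding expected_form_def stage_cost_def
      using c(1)
      by (subst nn_integral_cmult[symmetric])
        (auto intro!: nn_integral_mono simp: ennreal_mult'[symmetric] ennreal_leI)
  qed
  have "stage_cost Q x0 u \<longlonglongrightarrow> 0"
  proof -
    have "stage_cost Q x0 u k \<noteq> \<infinity>" for k
      using fin ennreal_suminf_lessD[of "stage_cost Q x0 u" top k] by (auto simp: less_top)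
    then have eq: "stage_cost Q x0 u k = ennreal (enn2real (stage_cost Q x0 u k))" for k
      by (simp add: less_top)
    have "summable (\<lambda>k. enn2real (stage_cost Q x0 u k))"
    proof (rule summable_suminf_not_top)
      show "(\<Sum>k. ennreal (enn2real (stage_cost Q x0 u k))) \<noteq> top"
        using fin by (simp only: eq[symmetric] infinity_ennreal_def not_False_eq_True)
    qed simp
    then have "(\<lambda>k. ennreal (enn2real (stage_cost Q x0 u k))) \<longlonglongrightarrow> ennreal 0"
      by (intro tendsto_ennrealI summable_LIMSEQ_zero)
    then show ?thesis by (simp only: eq[symmetric] ennreal_0)
  qed
  then have "(\<lambda>k. ennreal (norm X / c) * stage_cost Q x0 u k) \<longlonglongrightarrow> ennreal (norm X / c) * 0"
    by (intro ennreal_tendsto_cmult) simp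
  then have upper: "(\<lambda>k. ennreal (norm X / c) * stage_cost Q x0 u k) \<longlonglongrightarrow> 0"
    by (simp only: mult_zero_right)
  show ?thesis
    by (rule tendsto_sandwich[OF always_eventually always_eventually tendsto_const upper]) (simp_all add: le)
qed

lemma cost_lower_bound:
  assumes gen: "generates \<psi> x0 u" and Q: "sym_pos_def Q" and P: "sym_pos_semidef P"
    and fix_P: "P = Q + riccati_map 0 P"
  shows "ennreal (x0 \<bullet> (P *v x0)) \<le> cost M A B Q R x0 u"
proof (cases "cost M A B Q R x0 u = \<infinity>")
  case False
  note Qs = sym_pos_def_imp_semidef[OF Q]
  have "expected_form P x0 u k \<le> stage_cost Q x0 u k + expected_form P x0 u (Suc k)" for k
    unfolding stage_cost_split[OF gen Qs P] expected_form_fixed_point[OF gen Qs P fix_P, of k]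
    by (intro add_left_mono expected_step_ge[OF gen P])
  then have partial: "expected_form P x0 u 0 \<le> (\<Sum>k<T. stage_cost Q x0 u k) + expected_form P x0 u T" for T
    by (induction T) (auto simp: add.assoc intro: order_trans add_left_mono)
  have "ennreal (x0 \<bullet> (P *v x0)) \<le> (\<Sum>k. stage_cost Q x0 u k) + expected_form P x0 u T" for T
    by (rule order_trans[OF partial[of T, unfolded expected_form_0]])
      (intro add_right_mono sum_le_suminf summableI; simp)
  moreover have "(\<lambda>T. (\<Sum>k. stage_cost Q x0 u k) + expected_form P x0 u T)
      \<longlonglongrightarrow> (\<Sum>k. stage_cost Q x0 u k) + 0"
    using False by (intro tendsto_add tendsto_const expected_form_tendsto_0[OF gen Q])
      (simp add: cost_eq_suminf[OF gen Qs])
  ultimately show ?thesis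
    unfolding cost_eq_suminf[OF gen Qs] by (intro LIMSEQ_le_const) auto
qed simp

lemma cost_optimal:
  fixes P x0
  defines "u \<equiv> closed_loop_input A B (optimal_feedback M \<sigma> \<tau> A Abar B R P) x0"
  assumes Q: "sym_pos_def Q" and P: "sym_pos_semidef P" and fix_P: "P = Q + riccati_map 0 P"
  shows "cost M A B Q R x0 u = ennreal (x0 \<bullet> (P *v x0))"
proof (rule antisym)
  note gen = generates_optimal[of P x0, folded u_def]
  note Qs = sym_pos_def_imp_semidef[OF Q]
  have step: "expected_form P x0 u k = stage_cost Q x0 u k + expected_form P x0 u (Suc k)" for k
    unfolding stage_cost_split[OF gen Qs P] expected_form_fixed_point[OF gen Qs P fix_P, of k]
    unfolding u_def expected_step_optimal[OF P] ..
  have "expected_form P x0 u 0 = (\<Sum>k<T. stage_cost Q x0 u k) + expected_form P x0 u T" for T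
  proof (induction T)
    case (Suc T)
    show ?case unfolding sum.lessThan_Suc add.assoc step[symmetric] by (rule Suc)
  qed simp
  then have "(\<Sum>k<T. stage_cost Q x0 u k) \<le> ennreal (x0 \<bullet> (P *v x0))" for T
    unfolding expected_form_0 by (metis le_iff_add)
  then show "cost M A B Q R x0 u \<le> ennreal (x0 \<bullet> (P *v x0))"
    unfolding cost_eq_suminf[OF gen Qs] by (intro suminf_le_const summableI)
  show "ennreal (x0 \<bullet> (P *v x0)) \<le> cost M A B Q R x0 u"
    by (rule cost_lower_bound[OF gen Q P fix_P])
qed

lemma optimal_feedback_stable:
  assumes Q: "sym_pos_def Q" and P: "sym_pos_semidef P" and fix_P: "P = Q + riccati_map 0 P"
  shows "mean_square_stable M A B (optimal_feedback M \<sigma> \<tau> A Abar B R P)"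
  unfolding mean_square_stable_def
proof
  fix x0
  let ?u = "closed_loop_input A B (optimal_feedback M \<sigma> \<tau> A Abar B R P) x0"
  have "(\<Sum>k. stage_cost Q x0 ?u k) \<noteq> \<infinity>"
    using cost_optimal[OF assms, of x0]
    by (simp add: cost_eq_suminf[OF generates_optimal sym_pos_def_imp_semidef[OF Q]])
  from expected_form_tendsto_0[OF generates_optimal Q this, of "mat 1"]
  show "(\<lambda>k. \<integral>\<^sup>+\<omega>. ennreal
      (closed_loop_state A B (optimal_feedback M \<sigma> \<tau> A Abar B R P) x0 k \<omega> \<bullet>
       closed_loop_state A B (optimal_feedback M \<sigma> \<tau> A Abar B R P) x0 k \<omega>) \<partial>M) \<longlonglongrightarrow> 0"
    by (simp add: expected_form_def[abs_def] state_closed_loop_input)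
qed

lemma optimal_input_minimal:
  assumes Q: "sym_pos_def Q" and P: "sym_pos_semidef P" and fix_P: "P = Q + riccati_map 0 P"
    and v: "v \<in> limited_info_inputs M \<sigma> \<tau> A B x0"
  shows "ennreal (x0 \<bullet> (P *v x0)) \<le> cost M A B Q R x0 v"
  using v cost_lower_bound[OF _ Q P fix_P] by (auto simp: limited_info_inputs_iff)

lemma optimal_input_limited_info:
  "closed_loop_input A B (optimal_feedback M \<sigma> \<tau> A Abar B R P) x0 \<in> limited_info_inputs M \<sigma> \<tau> A B x0"
  using generates_optimal by (auto simp: limited_info_inputs_iff)

text \<open>The optimal cost determines its quadratic form, hence the matrix.\<close>

lemma riccati_fixed_point_unique:
  assumes Q: "sym_pos_def Q"
    and P: "sym_pos_semidef P" "P = Q + riccati_map 0 P"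
    and P': "sym_pos_semidef P'" "P' = Q + riccati_map 0 P'"
  shows "P' = P"
proof (rule symmetric_matrix_eqI)
  show "transpose P' = P'" "transpose P = P" using P P' by (auto simp: sym_pos_semidef_def)
  fix x
  have "ennreal (x \<bullet> (P' *v x)) \<le> ennreal (x \<bullet> (P *v x))"
    using optimal_input_minimal[OF Q P' optimal_input_limited_info, of x P]
    unfolding cost_optimal[OF Q P] .
  moreover have "ennreal (x \<bullet> (P *v x)) \<le> ennreal (x \<bullet> (P' *v x))"
    using optimal_input_minimal[OF Q P optimal_input_limited_info, of x P']
    unfolding cost_optimal[OF Q P'] .
  ultimately show "x \<bullet> (P' *v x) = x \<bullet> (P *v x)"
    using sym_pos_semidefD(2)[OF P(1), of x] sym_pos_semidefD(2)[OF P'(1), of x] by simp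
qed

end

theorem theorem2:
  fixes M :: "'w measure"
    and \<sigma> :: "'n::finite \<Rightarrow> 's::finite"
    and \<tau> :: "'m::finite \<Rightarrow> 's"
    and A :: "nat \<Rightarrow> 'w \<Rightarrow> real^'n^'n"
    and Abar :: "real^'n^'n"
    and Sig :: "real^('n \<times> 'n)^('n \<times> 'n)"
    and B :: "real^'m^'n"
    and Q :: "real^'n^'n"
    and R :: "real^'m^'m"
  assumes "prob_space M"
    and "surj \<sigma>" and "surj \<tau>"
    and "\<And>k. A k \<in> borel_measurable M"
    and "\<And>k. integrable M (A k)"
    and "\<And>k. integrable M (\<lambda>\<omega>. kronecker (A k \<omega>) (A k \<omega>))"
    and "prob_space.indep_vars M (\<lambda>_. borel) (\<lambda>(i, k) \<omega>. row_block \<sigma> i (A k \<omega>))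
           (UNIV :: ('s \<times> nat) set)"
    and "\<And>k. (\<integral>\<omega>. A k \<omega> \<partial>M) = Abar"
    and "\<And>k. (\<integral>\<omega>. kronecker (A k \<omega>) (A k \<omega>) \<partial>M) = Sig"
    and "block_diagonal \<sigma> \<tau> B"
    and "mean_square_stabilizable M A B"
    and "sym_pos_def Q"
    and "sym_pos_def R" and "block_diagonal \<tau> \<tau> R"
  shows "\<exists>P. sym_pos_def P
           \<and> (\<forall>k. modified_dare M \<sigma> \<tau> A Abar B Q R k P)
           \<and> (\<forall>P' k. sym_pos_def P' \<and> modified_dare M \<sigma> \<tau> A Abar B Q R k P' \<longrightarrow> P' = P)
           \<and> (\<forall>x0. let u = closed_loop_input A B (optimal_feedback M \<sigma> \<tau> A Abar B R P) x0
                   in u \<in> limited_info_inputs M \<sigma> \<tau> A B x0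
                      \<and> (\<forall>v \<in> limited_info_inputs M \<sigma> \<tau> A B x0.
                            cost M A B Q R x0 u \<le> cost M A B Q R x0 v))
           \<and> mean_square_stable M A B (optimal_feedback M \<sigma> \<tau> A Abar B R P)
           \<and> (\<forall>x0. (INF v \<in> limited_info_inputs M \<sigma> \<tau> A B x0. cost M A B Q R x0 v)
                     = ennreal (x0 \<bullet> (P *v x0)))"
proof -
  interpret prob_space M by (rule assms(1))
  interpret networked_system M \<sigma> \<tau> A Abar Sig B R
    by unfold_locales (use assms in auto)
  have dare: "modified_dare M \<sigma> \<tau> A Abar B Q R k P \<longleftrightarrow> P = Q + riccati_map 0 P" for k P
    by (simp add: modified_dare_iff riccati_map_time_invariant[of k P 0])
  note Q = \<open>sym_pos_def Q\<close>
  obtain P where P: "sym_pos_def P" and fix_P: "P = Q + riccati_map 0 P"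
    using riccati_fixed_point_exists[OF Q \<open>mean_square_stabilizable M A B\<close>] by blast
  note Ps = sym_pos_def_imp_semidef[OF P]
  let ?u = "closed_loop_input A B (optimal_feedback M \<sigma> \<tau> A Abar B R P)"
  have opt: "cost M A B Q R x0 (?u x0) = ennreal (x0 \<bullet> (P *v x0))" for x0
    by (rule cost_optimal[OF Q Ps fix_P])
  have lower: "ennreal (x0 \<bullet> (P *v x0)) \<le> cost M A B Q R x0 v"
    if "v \<in> limited_info_inputs M \<sigma> \<tau> A B x0" for x0 v
    by (rule optimal_input_minimal[OF Q Ps fix_P that])
  show ?thesis
  proof (intro exI[of _ P] conjI allI impI)
    show "sym_pos_def P" by (rule P)
    show "modified_dare M \<sigma> \<tau> A Abar B Q R k P" for k
      using fix_P by (simp only: dare)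
    show "P' = P" if "sym_pos_def P' \<and> modified_dare M \<sigma> \<tau> A Abar B Q R k P'" for P' k
      using that riccati_fixed_point_unique[OF Q Ps fix_P, of P'] sym_pos_def_imp_semidef[of P']
      by (simp only: dare)
    show "let u = ?u x0
          in u \<in> limited_info_inputs M \<sigma> \<tau> A B x0
             \<and> (\<forall>v \<in> limited_info_inputs M \<sigma> \<tau> A B x0. cost M A B Q R x0 u \<le> cost M A B Q R x0 v)" for x0
      unfolding Let_def opt using optimal_input_limited_info lower by blast
    show "mean_square_stable M A B (optimal_feedback M \<sigma> \<tau> A Abar B R P)"
      by (rule optimal_feedback_stable[OF Q Ps fix_P])
    show "(INF v \<in> limited_info_inputs M \<sigma> \<tau> A B x0. cost M A B Q R x0 v) = ennreal (x0 \<bullet> (P *v x0))" for x0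
    proof (rule antisym)
      show "(INF v \<in> limited_info_inputs M \<sigma> \<tau> A B x0. cost M A B Q R x0 v) \<le> ennreal (x0 \<bullet> (P *v x0))"
        using INF_lower[OF optimal_input_limited_info, of "cost M A B Q R x0" x0 P] by (simp only: opt)
      show "ennreal (x0 \<bullet> (P *v x0)) \<le> (INF v \<in> limited_info_inputs M \<sigma> \<tau> A B x0. cost M A B Q R x0 v)"
        by (rule INF_greatest) (rule lower)
    qed
  qed
qed

end
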